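(* For every $n\ge 1$, the edge labeling $\lambda_w$ of the weighted partition poset $\Pi_n^w$ is an EW-labeling. Consequently, $\Pi_n^w$ has a Whitney dual.
   Context: A weighted set is a pair $(A,v)$, written $A^v$, where $A$ is a nonempty finite set and $v\in\{0,\dots,|A|-1\}$. A weighted partition of $[n]$ is a collection $B_1^{v_1}/\cdots/B_t^{v_t}$ of weighted sets such that $B_1/\cdots/B_t$ is a set partition of $[n]$. The poset $\Pi_n^w$ is the set of weighted partitions of $[n]$ with cover relations $\pi\lessdot\pi'$ exactly when $\pi'$ is obtained from $\pi$ by replacing two blocks $A^{a},B^{b}$ by the single block $(A\cup B)^{a+b+u}$ for some $u\in\{0,1\}$, all other blocks unchanged. Its minimum is $\hat0=\{1\}^0/\cdots/\{n\}^0$; it is graded with rank $n$ minus the number of blocks. Label poset $\Lambda_n^w$: for $a\in[n-1]$ let $\Gamma_a=\{(a,b)^u: a<b\le n,\ u\in\{0,1\}\}$ ordered by $(a,b)^u\le(a,c)^v$ iff $b\le c$ and $u\le v$; $\Lambda_n^w=\Gamma_1\oplus\Gamma_2\oplus\cdots\oplus\Gamma_{n-1}$ is the ordinal sum (every element of $\Gamma_a$ is below every element of $\Gamma_{a'}$ when $a<a'$). The labeling $\lambda_w$ assigns to the cover obtained by merging $A^{a}$ and $B^{b}$ into $(A\cup B)^{a+b+u}$, with $\min A<\min B$, the label $(\min A,\min B)^u$. An edge labeling $\lambda$ of a poset $P$ assigns to each cover relation an element of a poset $\Lambda$. A saturated chain $x_0\lessdot\cdots\lessdot x_m$ is increasing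 if $\lambda(x_{i-1}\lessdot x_i)<\lambda(x_i\lessdot x_{i+1})$ for all $i$, and ascent-free if $\lambda(x_{i-1}\lessdot x_i)\not<\lambda(x_i\lessdot x_{i+1})$ for all $i$. $\lambda$ is an ER-labeling if every closed interval has a unique increasing maximal chain. $\lambda$ is an EW-labeling if (1) it is an ER-labeling; (2) (rank two switching) for every interval $[x,y]$ with $\rho(y)-\rho(x)=2$, if its increasing chain has label sequence $ab$, then there is exactly one maximal chain of $[x,y]$ with label sequence $ba$; (3) for all $x<y$, distinct ascent-free maximal chains of $[x,y]$ have distinct label sequences. For a graded poset $P$ with minimum $\hat0$, the Whitney numbers are $w_k(P)=\sum_{\rho(x)=k}\mu(\hat0,x)$ (first kind) and $W_k(P)=\#\{x:\rho(x)=k\}$ (second kind). Graded posets $P,Q$ with minima are Whitney duals if $|w_k(P)|=W_k(Q)$ and $|w_k(Q)|=W_k(P)$ for all $k$. *)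

theory Defs
  imports Main "HOL-Library.Disjoint_Sets"
begin

section \<open>Graded posets\<close>

text \<open>A poset is given by a carrier \<^term>\<open>A\<close> and an order relation \<^term>\<open>r\<close> with
  \<^term>\<open>partial_order_on A r\<close>; \<^term>\<open>(x, y) \<in> r\<close> means \<open>x \<le> y\<close>.\<close>

definition strictly_below :: "'a rel \<Rightarrow> 'a \<Rightarrow> 'a \<Rightarrow> bool" where
  "strictly_below r x y \<longleftrightarrow> (x, y) \<in> r \<and> x \<noteq> y"

definition covers :: "'a rel \<Rightarrow> 'a \<Rightarrow> 'a \<Rightarrow> bool" where
  "covers r x y \<longleftrightarrow>
     strictly_below r x y \<and> \<not> (\<exists>z. strictly_below r x z \<and> strictly_below r z y)"

definition closed_interval :: "'a rel \<Rightarrow> 'a \<Rightarrow> 'a \<Rightarrow> 'a set" where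
  "closed_interval r x y = {z. (x, z) \<in> r \<and> (z, y) \<in> r}"

definition is_minimum :: "'a set \<Rightarrow> 'a rel \<Rightarrow> 'a \<Rightarrow> bool" where
  "is_minimum A r b \<longleftrightarrow> b \<in> A \<and> (\<forall>x\<in>A. (b, x) \<in> r)"

definition poset_minimum :: "'a set \<Rightarrow> 'a rel \<Rightarrow> 'a" where
  "poset_minimum A r = (THE b. is_minimum A r b)"

text \<open>A chain \<open>x\<^sub>0 \<lessdot> \<dots> \<lessdot> x\<^sub>m\<close> is the list of its \<open>m + 1\<close> elements; its length
  in the order-theoretic sense is \<open>m\<close>.\<close>

definition saturated_chain :: "'a set \<Rightarrow> 'a rel \<Rightarrow> 'a list \<Rightarrow> bool" where
  "saturated_chain A r c \<longleftrightarrow> c \<noteq> [] \<and> set c \<subseteq> A \<and> successively (covers r) c"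

definition chain_length :: "'a list \<Rightarrow> nat" where
  "chain_length c = length c - 1"

text \<open>In a finite poset the maximal chains of \<open>[x, y]\<close> are the saturated chains from
  \<open>x\<close> to \<open>y\<close>.\<close>

definition interval_maximal_chains :: "'a set \<Rightarrow> 'a rel \<Rightarrow> 'a \<Rightarrow> 'a \<Rightarrow> 'a list set" where
  "interval_maximal_chains A r x y = {c. saturated_chain A r c \<and> hd c = x \<and> last c = y}"

text \<open>The maximal chains of a whole finite poset: the saturated chains that cannot be prolonged
  at either end.\<close>

definition maximal_chain :: "'a set \<Rightarrow> 'a rel \<Rightarrow> 'a list \<Rightarrow> bool" where
  "maximal_chain A r c \<longleftrightarrow>
     saturated_chain A r c \<and>
     \<not> (\<exists>z\<in>A. strictly_below r z (hd c)) \<and> \<not> (\<exists>z\<in>A. strictly_below r (last c) z)"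

definition graded_poset :: "'a set \<Rightarrow> 'a rel \<Rightarrow> bool" where
  "graded_poset A r \<longleftrightarrow>
     finite A \<and> partial_order_on A r \<and> (\<exists>b. is_minimum A r b) \<and>
     (\<forall>c d. maximal_chain A r c \<longrightarrow> maximal_chain A r d \<longrightarrow> chain_length c = chain_length d)"

text \<open>The rank of \<open>x\<close> is the common length of the saturated chains from the minimum to \<open>x\<close>.\<close>

definition poset_rank :: "'a set \<Rightarrow> 'a rel \<Rightarrow> 'a \<Rightarrow> nat" where
  "poset_rank A r x =
     (THE k. \<exists>c \<in> interval_maximal_chains A r (poset_minimum A r) x. chain_length c = k)"


section \<open>The Moebius function and Whitney numbers\<close>

text \<open>The recursion \<open>\<mu>(x, x) = 1\<close>, \<open>\<mu>(x, y) = - \<Sum>\<^bsub>x \<le> z < y\<^esub> \<mu>(x, z)\<close>. The value is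
  \<open>0\<close> when \<open>x \<le> y\<close> fails; the conditions on \<^term>\<open>r\<close> are there for termination only and
  hold for every finite poset.\<close>

function moebius :: "'a rel \<Rightarrow> 'a \<Rightarrow> 'a \<Rightarrow> int" where
  "moebius r x y =
     (if \<not> (partial_order_on (Field r) r \<and> finite (closed_interval r x y)) \<or> (x, y) \<notin> r then 0
      else if x = y then 1
      else - (\<Sum>z\<in>{z. (x, z) \<in> r \<and> strictly_below r z y}. moebius r x z))"
  by pat_completeness auto
termination
proof (relation "measure (\<lambda>(r, x, y). card (closed_interval r x y))", goal_cases)
  case 1
  then show ?case by simp
next
  case (2 r x y z)
  then have p: "partial_order_on (Field r) r" and f: "finite (closed_interval r x y)"
    and xy: "(x, y) \<in> r" and z: "(z, y) \<in> r" "z \<noteq> y"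
    by (auto simp: strictly_below_def)
  have t: "trans r" and a: "antisym r" and yy: "(y, y) \<in> r"
    using p xy
    by (auto simp: partial_order_on_def preorder_on_def refl_on_def Field_def)
  have "closed_interval r x z \<subseteq> closed_interval r x y"
    using t z(1) by (auto simp: closed_interval_def dest: transD)
  moreover have "y \<notin> closed_interval r x z"
    using a z by (auto simp: closed_interval_def dest: antisymD)
  moreover have "y \<in> closed_interval r x y"
    using xy yy by (simp add: closed_interval_def)
  ultimately have "closed_interval r x z \<subset> closed_interval r x y"
    by blast
  then show ?case
    using f by (simp add: psubset_card_mono)
qed

declare moebius.simps [simp del]

definition whitney_first :: "'a set \<Rightarrow> 'a rel \<Rightarrow> nat \<Rightarrow> int" where
  "whitney_first A r k =
     (\<Sum>x\<in>{x \<in> A. poset_rank A r x = k}. moebius r (poset_minimum A r) x)"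

definition whitney_second :: "'a set \<Rightarrow> 'a rel \<Rightarrow> nat \<Rightarrow> nat" where
  "whitney_second A r k = card {x \<in> A. poset_rank A r x = k}"

definition whitney_duals :: "'a set \<Rightarrow> 'a rel \<Rightarrow> 'b set \<Rightarrow> 'b rel \<Rightarrow> bool" where
  "whitney_duals A r B s \<longleftrightarrow>
     graded_poset A r \<and> graded_poset B s \<and>
     (\<forall>k. \<bar>whitney_first A r k\<bar> = int (whitney_second B s k) \<and>
          \<bar>whitney_first B s k\<bar> = int (whitney_second A r k))"

text \<open>Graded posets are finite, so up to isomorphism the carrier of the dual can be taken to be
  a set of natural numbers.\<close>

definition has_whitney_dual :: "'a set \<Rightarrow> 'a rel \<Rightarrow> bool" where
  "has_whitney_dual A r \<longleftrightarrow> (\<exists>(B :: nat set) s. whitney_duals A r B s)"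


section \<open>Edge labelings\<close>

text \<open>A labeling \<^term>\<open>lam\<close> is evaluated at pairs \<open>x \<lessdot> y\<close> only. The label poset has carrier
  \<^term>\<open>L\<close> and order \<^term>\<open>le\<close>.\<close>

definition edge_labeling ::
  "'a set \<Rightarrow> 'a rel \<Rightarrow> 'l set \<Rightarrow> 'l rel \<Rightarrow> ('a \<Rightarrow> 'a \<Rightarrow> 'l) \<Rightarrow> bool" where
  "edge_labeling A r L le lam \<longleftrightarrow>
     partial_order_on A r \<and> partial_order_on L le \<and>
     (\<forall>x\<in>A. \<forall>y\<in>A. covers r x y \<longrightarrow> lam x y \<in> L)"

definition label_sequence :: "('a \<Rightarrow> 'a \<Rightarrow> 'l) \<Rightarrow> 'a list \<Rightarrow> 'l list" where
  "label_sequence lam c = map2 lam (butlast c) (tl c)"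

definition increasing_chain :: "'l rel \<Rightarrow> ('a \<Rightarrow> 'a \<Rightarrow> 'l) \<Rightarrow> 'a list \<Rightarrow> bool" where
  "increasing_chain le lam c \<longleftrightarrow> successively (strictly_below le) (label_sequence lam c)"

definition ascent_free_chain :: "'l rel \<Rightarrow> ('a \<Rightarrow> 'a \<Rightarrow> 'l) \<Rightarrow> 'a list \<Rightarrow> bool" where
  "ascent_free_chain le lam c \<longleftrightarrow>
     successively (\<lambda>l m. \<not> strictly_below le l m) (label_sequence lam c)"

definition ER_labeling ::
  "'a set \<Rightarrow> 'a rel \<Rightarrow> 'l set \<Rightarrow> 'l rel \<Rightarrow> ('a \<Rightarrow> 'a \<Rightarrow> 'l) \<Rightarrow> bool" where
  "ER_labeling A r L le lam \<longleftrightarrow>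
     edge_labeling A r L le lam \<and>
     (\<forall>x\<in>A. \<forall>y\<in>A. (x, y) \<in> r \<longrightarrow>
        (\<exists>!c. c \<in> interval_maximal_chains A r x y \<and> increasing_chain le lam c))"

definition rank_two_switching :: "'a set \<Rightarrow> 'a rel \<Rightarrow> 'l rel \<Rightarrow> ('a \<Rightarrow> 'a \<Rightarrow> 'l) \<Rightarrow> bool" where
  "rank_two_switching A r le lam \<longleftrightarrow>
     (\<forall>x\<in>A. \<forall>y\<in>A. (x, y) \<in> r \<longrightarrow> poset_rank A r y = poset_rank A r x + 2 \<longrightarrow>
        (\<forall>c\<in>interval_maximal_chains A r x y. \<forall>a b.
           increasing_chain le lam c \<longrightarrow> label_sequence lam c = [a, b] \<longrightarrow>
           (\<exists>!d. d \<in> interval_maximal_chains A r x y \<and> label_sequence lam d = [b, a])))"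

definition EW_labeling ::
  "'a set \<Rightarrow> 'a rel \<Rightarrow> 'l set \<Rightarrow> 'l rel \<Rightarrow> ('a \<Rightarrow> 'a \<Rightarrow> 'l) \<Rightarrow> bool" where
  "EW_labeling A r L le lam \<longleftrightarrow>
     graded_poset A r \<and>
     ER_labeling A r L le lam \<and>
     rank_two_switching A r le lam \<and>
     (\<forall>x\<in>A. \<forall>y\<in>A. strictly_below r x y \<longrightarrow>
        inj_on (label_sequence lam)
          {c \<in> interval_maximal_chains A r x y. ascent_free_chain le lam c})"


section \<open>Weighted partitions\<close>

text \<open>A weighted set \<open>B\<^sup>v\<close> is the pair \<^term>\<open>(B, v)\<close>.\<close>

type_synonym weighted_set = "nat set \<times> nat"

definition is_weighted_set :: "weighted_set \<Rightarrow> bool" where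
  "is_weighted_set = (\<lambda>(B, v). finite B \<and> B \<noteq> {} \<and> v \<in> {0..card B - 1})"

text \<open>Injectivity of \<^term>\<open>fst\<close> says that every block carries exactly one weight.\<close>

definition weighted_partitions :: "nat \<Rightarrow> weighted_set set set" where
  "weighted_partitions n =
     {\<pi>. (\<forall>W\<in>\<pi>. is_weighted_set W) \<and> inj_on fst \<pi> \<and> partition_on {1..n} (fst ` \<pi>)}"

text \<open>\<^term>\<open>\<pi>'\<close> arises from \<^term>\<open>\<pi>\<close> by replacing the blocks \<open>A\<^sup>a\<close> and \<open>B\<^sup>b\<close> by
  \<open>(A \<union> B)\<^bsup>a+b+u\<^esup>\<close>. The blocks are named such that \<open>min A < min B\<close>.\<close>

definition merges_to ::
  "weighted_set set \<Rightarrow> weighted_set \<Rightarrow> weighted_set \<Rightarrow> nat \<Rightarrow> weighted_set set \<Rightarrow> bool" where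
  "merges_to \<pi> = (\<lambda>(A, a) (B, b) u \<pi>'.
     (A, a) \<in> \<pi> \<and> (B, b) \<in> \<pi> \<and> Min A < Min B \<and> u \<in> {0, 1} \<and>
     \<pi>' = insert (A \<union> B, a + b + u) (\<pi> - {(A, a), (B, b)}))"

definition wp_cover :: "nat \<Rightarrow> weighted_set set rel" where
  "wp_cover n = {(\<pi>, \<pi>'). \<pi> \<in> weighted_partitions n \<and> \<pi>' \<in> weighted_partitions n \<and>
     (\<exists>V W u. merges_to \<pi> V W u \<pi>')}"

definition wp_le :: "nat \<Rightarrow> weighted_set set rel" where
  "wp_le n = (wp_cover n)\<^sup>* \<inter> weighted_partitions n \<times> weighted_partitions n"


section \<open>The label poset and the labeling\<close>

text \<open>The label \<open>(a, b)\<^sup>u\<close> is the triple \<^term>\<open>(a, b, u)\<close>.\<close>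

type_synonym wp_label = "nat \<times> nat \<times> nat"

definition wp_Gamma :: "nat \<Rightarrow> nat \<Rightarrow> wp_label set" where
  "wp_Gamma n a = {(a, b, u) | b u. a < b \<and> b \<le> n \<and> u \<in> {0, 1}}"

definition wp_Gamma_le :: "nat \<Rightarrow> nat \<Rightarrow> wp_label rel" where
  "wp_Gamma_le n a = {((a, b, u), (a, c, v)) | b u c v.
     (a, b, u) \<in> wp_Gamma n a \<and> (a, c, v) \<in> wp_Gamma n a \<and> b \<le> c \<and> u \<le> v}"

definition wp_Lambda :: "nat \<Rightarrow> wp_label set" where
  "wp_Lambda n = (\<Union>a\<in>{1..n - 1}. wp_Gamma n a)"

definition wp_Lambda_le :: "nat \<Rightarrow> wp_label rel" where
  "wp_Lambda_le n =
     (\<Union>a\<in>{1..n - 1}. wp_Gamma_le n a) \<union>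
     (\<Union>a\<in>{1..n - 1}. \<Union>a'\<in>{a<..n - 1}. wp_Gamma n a \<times> wp_Gamma n a')"

definition wp_labeling :: "weighted_set set \<Rightarrow> weighted_set set \<Rightarrow> wp_label" where
  "wp_labeling \<pi> \<pi>' =
     (THE l. \<exists>V W u. merges_to \<pi> V W u \<pi>' \<and> l = (Min (fst V), Min (fst W), u))"

end

theory Submission
  imports Defs "HOL-Library.FuncSet" "HOL-Library.Nat_Bijection"
begin

text \<open>
  If \<open>x \<le> y\<close>, then an increasing chain from \<open>x\<close> to \<open>y\<close> has to merge at each step the
  lexicographically least pair of block minima that lie in a common block of \<open>y\<close>, and has to
  postpone adding \<open>1\<close> to the weight of that block as long as possible; so it is unique. A label
  determines the blocks that it merges, so label sequences determine chains, and the two merges of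
  an increasing chain of length two commute.

  The Whitney dual is the poset of rooted forests on \<open>[n]\<close>, where a cover joins two trees by an edge
  between their roots. Below a forest this is a distributive lattice, so only the forests of stars
  have nonzero Moebius value, and they are equinumerous with the weighted partitions. For the
  converse, summing \<open>\<Sum>\<^bsub>x \<le> y\<^esub> \<mu>(0, x) = [y = 0]\<close> over all \<open>y\<close> of rank \<open>k\<close> gives
  \<open>\<Sum>\<^bsub>i \<le> k\<^esub> w\<^sub>i s(n - i, k - i) = [k = 0]\<close>, where \<open>s(m, j)\<close> counts the star forests with
  \<open>j\<close> edges on \<open>m\<close> vertices. The numbers of rooted forests with \<open>i\<close> edges and signs \<open>(-1)\<^sup>i\<close>
  satisfy the same system: a forest \<open>F\<close> together with a star forest \<open>S\<close> on its roots is a forest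
  \<open>F \<union> S\<close> with a marked set \<open>S\<close> of edges at its roots, and the signed sum over the marked sets
  vanishes.
\<close>

text \<open>Inside one \<open>wp_Gamma n a\<close> the labels \<open>(a, b, 1)\<close> and
  \<open>(a, c, 0)\<close> with \<open>b < c\<close> are incomparable. So once an increasing chain
  has added \<open>1\<close> while merging into the block with minimum \<open>a\<close>, it has to
  go on doing so, and the prescribed weight of the block decides when this begins.

  The order is defined as reachability by merges, which is awkward both for choosing a next step and
  for counting. The relation \<open>finer\<close> replaces it by bounds at each block of
  \<open>y\<close>: from \<open>c\<close> sub-blocks of total weight \<open>w\<close>, exactly the
  weights from \<open>w\<close> to \<open>w + c - 1\<close> can be reached. These \<open>c\<close>
  values are as many as the possible roots of a star on the \<open>c\<close> sub-blocks. Hence the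
  elements above \<open>x\<close> correspond to the star forests on the blocks of \<open>x\<close>,
  and their number in each rank depends on the number of blocks of \<open>x\<close> only. This is
  what allows the Moebius sums to be grouped by rank, so that the system involves no individual
  Moebius values.\<close>

lemma sum_minus_one_power_Pow:
  assumes "finite S" "S \<noteq> {}"
  shows "(\<Sum>T\<in>Pow S. (- 1) ^ card T) = (0 :: int)"
proof -
  obtain a where a: "a \<in> S" using assms by auto
  \<comment> \<open>Adding or removing \<open>a\<close> pairs the subsets of \<open>S\<close> with
    opposite signs.\<close>
  define S' where "S' = S - {a}"
  have S: "S = insert a S'" "a \<notin> S'" "finite S'" using a assms by (auto simp: S'_def)
  have "(\<Sum>T\<in>Pow S. (- 1) ^ card T) =
      (\<Sum>T\<in>Pow S'. (- 1) ^ card T) + (\<Sum>T\<in>insert a ` Pow S'. (- 1) ^ card T :: int)"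
    unfolding S(1) Pow_insert by (rule sum.union_disjoint) (use S in auto)
  also have "(\<Sum>T\<in>insert a ` Pow S'. (- 1) ^ card T :: int) = (\<Sum>T\<in>Pow S'. (- 1) ^ card (insert a T))"
    by (rule sum.reindex_cong[OF _ refl refl]) (use S(2) in \<open>auto simp: inj_on_def\<close>)
  also have "\<dots> = (\<Sum>T\<in>Pow S'. - ((- 1) ^ card T))"
  proof (rule sum.cong[OF refl])
    fix T assume "T \<in> Pow S'"
    then have "finite T" "a \<notin> T" using S finite_subset by auto
    then show "(- 1 :: int) ^ card (insert a T) = - ((- 1) ^ card T)" by simp
  qed
  finally show ?thesis by (simp add: sum_negf)
qed

section \<open>Finite posets with a rank function\<close>

lemma interval_maximal_chains_Cons:
  "x # c \<in> interval_maximal_chains A r u y \<longleftrightarrow>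
     u = x \<and> x \<in> A \<and>
     (if c = [] then x = y else covers r x (hd c) \<and> c \<in> interval_maximal_chains A r (hd c) y)"
  by (auto simp: interval_maximal_chains_def saturated_chain_def successively_Cons)

lemma Nil_notin_interval_maximal_chains: "[] \<notin> interval_maximal_chains A r x y"
  by (auto simp: interval_maximal_chains_def saturated_chain_def)

lemma label_sequence_Cons_Cons:
  "label_sequence lam (x # z # c) = lam x z # label_sequence lam (z # c)"
  by (simp add: label_sequence_def)

lemma label_sequence_singleton: "label_sequence lam [x] = []"
  by (simp add: label_sequence_def)

text \<open>A common interface for weighted partitions and forests. By \<open>rank_mono\<close> and
  \<open>rank_step\<close> every cover raises \<open>\<rho>\<close> by exactly one, so the definite
  description in \<open>poset_rank\<close> returns \<open>\<rho>\<close>. By \<open>rank_le\<close>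
  and \<open>not_maximal\<close> all maximal elements have rank \<open>N\<close>, which gives all
  maximal chains the same length.\<close>

locale ranked_poset =
  fixes A :: "'a set" and r :: "'a rel" and b :: 'a and \<rho> :: "'a \<Rightarrow> nat" and N :: nat
  assumes finite_carrier: "finite A"
    and order: "partial_order_on A r"
    and minimum: "is_minimum A r b"
    and rank_minimum: "\<rho> b = 0"
    and rank_mono: "strictly_below r x y \<Longrightarrow> \<rho> x < \<rho> y"
    and rank_step: "strictly_below r x y \<Longrightarrow>
          \<exists>z. strictly_below r x z \<and> (z, y) \<in> r \<and> \<rho> z = Suc (\<rho> x)"
    and rank_le: "x \<in> A \<Longrightarrow> \<rho> x \<le> N"
    and not_maximal: "x \<in> A \<Longrightarrow> \<rho> x < N \<Longrightarrow> \<exists>y. strictly_below r x y"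
begin

lemma below_carrier: "(x, y) \<in> r \<Longrightarrow> x \<in> A \<and> y \<in> A"
  and below_refl: "x \<in> A \<Longrightarrow> (x, x) \<in> r"
  and below_antisym: "(x, y) \<in> r \<Longrightarrow> (y, x) \<in> r \<Longrightarrow> x = y"
  using order
  by (auto simp: partial_order_on_def preorder_on_def refl_on_def dest: transD antisymD)

lemma minimum_carrier: "b \<in> A" and minimum_below: "x \<in> A \<Longrightarrow> (b, x) \<in> r"
  using minimum by (auto simp: is_minimum_def)

lemma covers_rank: assumes "covers r x y" shows "\<rho> y = Suc (\<rho> x)"
proof -
  obtain z where z: "strictly_below r x z" "(z, y) \<in> r" "\<rho> z = Suc (\<rho> x)"
    using rank_step assms unfolding covers_def by blast
  with assms have "z = y" by (auto simp: covers_def strictly_below_def)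
  with z show ?thesis by simp
qed

lemma coversI: assumes "strictly_below r x y" "\<rho> y = Suc (\<rho> x)" shows "covers r x y"
proof -
  have False if "strictly_below r x z" "strictly_below r z y" for z
    using rank_mono[OF that(1)] rank_mono[OF that(2)] assms(2) by simp
  with assms(1) show ?thesis by (auto simp: covers_def)
qed

lemma interval_maximal_chain_rank:
  "c \<in> interval_maximal_chains A r x y \<Longrightarrow> \<rho> y = \<rho> x + chain_length c"
proof (induction c arbitrary: x)
  case Nil
  then show ?case by (simp add: Nil_notin_interval_maximal_chains)
next
  case (Cons a c)
  show ?case
  proof (cases "c = []")
    case True
    with Cons.prems show ?thesis by (simp add: interval_maximal_chains_Cons chain_length_def)
  next
    case False
    with Cons.prems have c: "c \<in> interval_maximal_chains A r (hd c) y" "covers r x (hd c)"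
      by (auto simp: interval_maximal_chains_Cons)
    show ?thesis using Cons.IH[OF c(1)] covers_rank[OF c(2)] False
      by (cases c) (auto simp: chain_length_def)
  qed
qed

lemma interval_maximal_chain_exists:
  "(x, y) \<in> r \<Longrightarrow> \<exists>c. c \<in> interval_maximal_chains A r x y"
proof (induction "\<rho> y - \<rho> x" arbitrary: x rule: less_induct)
  case less
  show ?case
  proof (cases "x = y")
    case True
    then have "[x] \<in> interval_maximal_chains A r x y"
      using less.prems below_carrier by (auto simp: interval_maximal_chains_Cons)
    then show ?thesis by blast
  next
    case False
    then have "strictly_below r x y" using less.prems by (simp add: strictly_below_def)
    then obtain z where z: "strictly_below r x z" "(z, y) \<in> r" "\<rho> z = Suc (\<rho> x)"
      using rank_step by blast
    have "\<rho> x < \<rho> y" using \<open>strictly_below r x y\<close> rank_mono by blast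
    then obtain c where c: "c \<in> interval_maximal_chains A r z y"
      using less.hyps[of z] z by fastforce
    then have "c \<noteq> []" "hd c = z"
      by (auto simp: interval_maximal_chains_def saturated_chain_def)
    with c coversI[OF z(1,3)] below_carrier[OF less.prems]
    have "x # c \<in> interval_maximal_chains A r x y"
      by (simp add: interval_maximal_chains_Cons)
    then show ?thesis by blast
  qed
qed

lemma poset_minimum: "poset_minimum A r = b"
  unfolding poset_minimum_def
  using minimum by (rule the_equality)
    (auto simp: is_minimum_def intro: below_antisym minimum_below minimum_carrier)

lemma poset_rank: assumes "x \<in> A" shows "poset_rank A r x = \<rho> x"
proof -
  obtain c where c: "c \<in> interval_maximal_chains A r b x"
    using interval_maximal_chain_exists minimum_below assms by blast
  show ?thesis
    unfolding poset_rank_def poset_minimum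
    by (rule the_equality)
       (use c interval_maximal_chain_rank[of _ b x] rank_minimum in \<open>metis add_0\<close>)+
qed

lemma graded_poset: "graded_poset A r"
proof -
  have "chain_length c = N" if "maximal_chain A r c" for c
  proof -
    have c: "saturated_chain A r c" "\<not> (\<exists>z\<in>A. strictly_below r z (hd c))"
      "\<not> (\<exists>z\<in>A. strictly_below r (last c) z)"
      using that by (auto simp: maximal_chain_def)
    then have A: "hd c \<in> A" "last c \<in> A" by (auto simp: saturated_chain_def)
    have "hd c = b"
      using c(2) minimum_below[OF A(1)] minimum_carrier by (auto simp: strictly_below_def)
    moreover have "\<rho> (last c) = N"
    proof (rule ccontr)
      assume "\<rho> (last c) \<noteq> N"
      then obtain y where "strictly_below r (last c) y"
        using rank_le[OF A(2)] not_maximal[OF A(2)] by (auto simp: le_less)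
      then show False using c(3) below_carrier by (auto simp: strictly_below_def)
    qed
    moreover have "c \<in> interval_maximal_chains A r (hd c) (last c)"
      using c by (simp add: interval_maximal_chains_def)
    ultimately show ?thesis using interval_maximal_chain_rank rank_minimum by fastforce
  qed
  then show ?thesis
    unfolding graded_poset_def using finite_carrier order minimum by auto
qed

lemma whitney_second_rank: "whitney_second A r k = card {x \<in> A. \<rho> x = k}"
  unfolding whitney_second_def using poset_rank by (metis (mono_tags, lifting))

lemma whitney_first_rank: "whitney_first A r k = (\<Sum>x\<in>{x \<in> A. \<rho> x = k}. moebius r b x)"
  unfolding whitney_first_def poset_minimum
  by (rule sum.cong) (auto simp: poset_rank)

section \<open>The Moebius function from the minimum\<close>

lemma moebius_eq:
  assumes y: "y \<in> A"
  shows "moebius r b y = (if y = b then 1 else - (\<Sum>x\<in>{x. strictly_below r x y}. moebius r b x))"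
proof -
  have "Field r = A" using below_carrier below_refl by (auto simp: Field_def)
  moreover have "finite (closed_interval r b y)"
    by (rule finite_subset[OF _ finite_carrier]) (use below_carrier in \<open>auto simp: closed_interval_def\<close>)
  moreover have "{z. (b, z) \<in> r \<and> strictly_below r z y} = {x. strictly_below r x y}"
    using minimum_below below_carrier by (auto simp: strictly_below_def)
  ultimately show ?thesis
    using order minimum_below[OF y] by (subst moebius.simps) auto
qed

lemma sum_down_set:
  fixes f :: "'a \<Rightarrow> int"
  assumes "y \<in> A"
  shows "(\<Sum>x\<in>{x. (x, y) \<in> r}. f x) = f y + (\<Sum>x\<in>{x. strictly_below r x y}. f x)"
proof -
  have "{x. (x, y) \<in> r} = insert y {x. strictly_below r x y}"
    using below_refl[OF assms] by (auto simp: strictly_below_def)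
  moreover have "finite {x. strictly_below r x y}"
    by (rule finite_subset[OF _ finite_carrier]) (use below_carrier in \<open>auto simp: strictly_below_def\<close>)
  ultimately show ?thesis by (simp add: strictly_below_def)
qed

lemma sum_moebius:
  assumes "y \<in> A"
  shows "(\<Sum>x\<in>{x. (x, y) \<in> r}. moebius r b x) = (if y = b then 1 else 0)"
proof -
  have "{x. strictly_below r x b} = {}"
    using rank_mono[of _ b] rank_minimum by auto
  then show ?thesis
    by (simp add: sum_down_set[OF assms] moebius_eq[OF assms])
qed

text \<open>The conditions are triangular in the rank. A guessed function can therefore be verified
  through its sums over lower sets; the Moebius values of the forest poset are obtained in this
  way.\<close>

lemma moebius_unique:
  assumes f: "\<And>y. y \<in> A \<Longrightarrow> (\<Sum>x\<in>{x. (x, y) \<in> r}. f x) = (if y = b then 1 else 0)"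
  shows "y \<in> A \<Longrightarrow> moebius r b y = f y"
proof (induction "\<rho> y" arbitrary: y rule: less_induct)
  case less
  have "(\<Sum>x\<in>{x. strictly_below r x y}. moebius r b x) = (\<Sum>x\<in>{x. strictly_below r x y}. f x)"
    by (rule sum.cong)
       (use less.hyps rank_mono below_carrier in \<open>auto simp: strictly_below_def\<close>)
  then show ?case
    using f[OF less.prems] sum_moebius[OF less.prems]
    by (simp add: sum_down_set[OF less.prems])
qed

end

lemma card_ge_2_other:
  assumes "2 \<le> card S"
  shows "\<exists>b\<in>S. b \<noteq> a"
proof (rule ccontr)
  assume "\<not> ?thesis"
  then have "S \<subseteq> {a}" by blast
  then have "card S \<le> card {a}" by (intro card_mono) auto
  with assms show False by simp
qed

section \<open>Merging blocks\<close>

lemma weighted_partitions_block: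
  assumes "x \<in> weighted_partitions n" "V \<in> x"
  shows "finite (fst V)" "fst V \<noteq> {}" "snd V < card (fst V)" "fst V \<subseteq> {1..n}"
proof -
  have "is_weighted_set V" using assms by (auto simp: weighted_partitions_def)
  then have "finite (fst V)" "fst V \<noteq> {}" "snd V \<le> card (fst V) - 1"
    by (auto simp: is_weighted_set_def split: prod.splits)
  moreover from this have "card (fst V) > 0" by (simp add: card_gt_0_iff)
  ultimately show "finite (fst V)" "fst V \<noteq> {}" "snd V < card (fst V)" by auto
  have "fst V \<subseteq> \<Union> (fst ` x)" using assms by auto
  then show "fst V \<subseteq> {1..n}"
    using assms by (auto simp: weighted_partitions_def partition_on_def)
qed

lemma weighted_partitions_inter:
  assumes "x \<in> weighted_partitions n" "V \<in> x" "W \<in> x" "i \<in> fst V" "i \<in> fst W"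
  shows "V = W"
proof -
  have "disjoint (fst ` x)" "inj_on fst x"
    using assms by (auto simp: weighted_partitions_def partition_on_def)
  with assms have "fst V = fst W" by (auto simp: disjoint_def)
  with \<open>inj_on fst x\<close> assms show ?thesis by (auto dest: inj_onD)
qed

lemma weighted_partitions_cover:
  assumes "x \<in> weighted_partitions n" "i \<in> {1..n}"
  obtains V where "V \<in> x" "i \<in> fst V"
proof -
  have "\<Union> (fst ` x) = {1..n}" using assms by (auto simp: weighted_partitions_def partition_on_def)
  with assms(2) show ?thesis using that by blast
qed

lemma weighted_partitionsI:
  assumes "\<And>V. V \<in> x \<Longrightarrow> finite (fst V) \<and> fst V \<noteq> {} \<and> snd V < card (fst V)"
    and "\<And>V W i. V \<in> x \<Longrightarrow> W \<in> x \<Longrightarrow> i \<in> fst V \<Longrightarrow> i \<in> fst W \<Longrightarrow> V = W"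
    and "(\<Union>V\<in>x. fst V) = {1..n}"
  shows "x \<in> weighted_partitions n"
proof -
  have "is_weighted_set V" if "V \<in> x" for V
    using assms(1)[OF that] by (auto simp: is_weighted_set_def split: prod.splits)
  moreover have "inj_on fst x"
  proof (rule inj_onI)
    fix V W assume "V \<in> x" "W \<in> x" "fst V = fst W"
    moreover from this assms(1) obtain i where "i \<in> fst V" by blast
    ultimately show "V = W" using assms(2) by simp
  qed
  moreover have "partition_on {1..n} (fst ` x)"
    unfolding partition_on_def disjoint_def
  proof (intro conjI ballI impI)
    fix p q assume "p \<in> fst ` x" "q \<in> fst ` x" "p \<noteq> q"
    then obtain V W where "V \<in> x" "W \<in> x" "p = fst V" "q = fst W" by blast
    with \<open>p \<noteq> q\<close> assms(2)[of V W] show "p \<inter> q = {}" by blast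
  qed (use assms(1,3) in auto)
  ultimately show ?thesis by (simp add: weighted_partitions_def)
qed

lemma weighted_partitions_finite: assumes "x \<in> weighted_partitions n" shows "finite x"
proof -
  have "finite (fst ` x)" "inj_on fst x"
    using assms finite_elements[of "{1..n}" "fst ` x"] by (auto simp: weighted_partitions_def)
  then show ?thesis using finite_imageD by blast
qed

lemma finite_weighted_partitions: "finite (weighted_partitions n)"
proof (rule finite_subset)
  show "weighted_partitions n \<subseteq> Pow (Pow {1..n} \<times> {..n})"
  proof (clarsimp, intro conjI subsetI)
    fix x B v i assume x: "x \<in> weighted_partitions n" "(B, v) \<in> x"
    note b = weighted_partitions_block[OF x, simplified]
    show "v \<le> n" using b card_mono[OF _ b(4)] by simp
    show "i \<in> {Suc 0..n}" if "i \<in> B" using b(4) that by auto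
  qed
qed auto

abbreviation block_min :: "weighted_set \<Rightarrow> nat" where
  "block_min V \<equiv> Min (fst V)"

lemma block_min_in: "x \<in> weighted_partitions n \<Longrightarrow> V \<in> x \<Longrightarrow> block_min V \<in> fst V"
  by (simp add: weighted_partitions_block)

lemma block_min_inj:
  "x \<in> weighted_partitions n \<Longrightarrow> V \<in> x \<Longrightarrow> W \<in> x \<Longrightarrow> block_min V = block_min W \<Longrightarrow> V = W"
  by (metis block_min_in weighted_partitions_inter)

lemma block_min_inj_on: "x \<in> weighted_partitions n \<Longrightarrow> inj_on (\<lambda>V. block_min V) x"
  by (rule inj_onI) (rule block_min_inj)

definition join_blocks :: "weighted_set \<Rightarrow> weighted_set \<Rightarrow> nat \<Rightarrow> weighted_set" where
  "join_blocks V W u = (fst V \<union> fst W, snd V + snd W + u)"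

definition merge :: "weighted_set set \<Rightarrow> weighted_set \<Rightarrow> weighted_set \<Rightarrow> nat \<Rightarrow> weighted_set set" where
  "merge x V W u = insert (join_blocks V W u) (x - {V, W})"

definition mergeable :: "weighted_set set \<Rightarrow> weighted_set \<Rightarrow> weighted_set \<Rightarrow> nat \<Rightarrow> bool" where
  "mergeable x V W u \<longleftrightarrow> V \<in> x \<and> W \<in> x \<and> block_min V < block_min W \<and> u \<le> 1"

lemma merges_to_iff: "merges_to x V W u x' \<longleftrightarrow> mergeable x V W u \<and> x' = merge x V W u"
  by (cases V; cases W) (auto simp: merges_to_def mergeable_def merge_def join_blocks_def)

lemma join_blocks_min:
  assumes "x \<in> weighted_partitions n" "mergeable x V W u"
  shows "block_min (join_blocks V W u) = block_min V"
  using assms weighted_partitions_block[OF assms(1), of V] weighted_partitions_block[OF assms(1), of W]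
  by (auto simp: join_blocks_def mergeable_def Min_Un)

text \<open>A block of \<open>x\<close> that contains both minima would coincide with
  \<open>V\<close> and with \<open>W\<close>. Thus a merge always adds something new, so
  cardinalities and sums over blocks can be updated exactly.\<close>

lemma join_blocks_notin:
  assumes x: "x \<in> weighted_partitions n" and m: "mergeable x V W u"
  shows "join_blocks V W u \<notin> x"
proof
  assume "join_blocks V W u \<in> x"
  moreover have VW: "V \<in> x" "W \<in> x" "V \<noteq> W" using m by (auto simp: mergeable_def)
  moreover have "block_min V \<in> fst (join_blocks V W u)" "block_min W \<in> fst (join_blocks V W u)"
    using VW block_min_in[OF x] by (auto simp: join_blocks_def)
  ultimately show False
    using weighted_partitions_inter[OF x] block_min_in[OF x] by metis
qed

lemma merge_weighted_partitions:
  assumes x: "x \<in> weighted_partitions n" and m: "mergeable x V W u"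
  shows "merge x V W u \<in> weighted_partitions n"
proof (rule weighted_partitionsI)
  have VW: "V \<in> x" "W \<in> x" "V \<noteq> W" "u \<le> 1" using m by (auto simp: mergeable_def)
  note V = weighted_partitions_block[OF x VW(1)] and W = weighted_partitions_block[OF x VW(2)]
  have "fst V \<inter> fst W = {}" using weighted_partitions_inter[OF x VW(1,2)] VW(3) by blast
  then have "card (fst V \<union> fst W) = card (fst V) + card (fst W)"
    using V W by (simp add: card_Un_disjoint)
  then have J: "finite (fst (join_blocks V W u)) \<and> fst (join_blocks V W u) \<noteq> {} \<and>
      snd (join_blocks V W u) < card (fst (join_blocks V W u))"
    using V W VW by (auto simp: join_blocks_def)
  show "finite (fst U) \<and> fst U \<noteq> {} \<and> snd U < card (fst U)" if "U \<in> merge x V W u" for U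
    using that J weighted_partitions_block[OF x, of U] unfolding merge_def by blast
  show "U = U'" if "U \<in> merge x V W u" "U' \<in> merge x V W u" "i \<in> fst U" "i \<in> fst U'" for U U' i
  proof -
    have *: "U = V \<or> U = W" if "U \<in> x" "i \<in> fst U" "i \<in> fst (join_blocks V W u)" for U
      using that weighted_partitions_inter[OF x that(1) VW(1)] weighted_partitions_inter[OF x that(1) VW(2)]
      unfolding join_blocks_def by auto
    show ?thesis
      using that *[of U] *[of U'] weighted_partitions_inter[OF x, of U U' i] unfolding merge_def by blast
  qed
  have "(\<Union>U\<in>x. fst U) = {1..n}"
    using x by (auto simp: weighted_partitions_def partition_on_def)
  then show "(\<Union>U\<in>merge x V W u. fst U) = {1..n}"
    using VW by (auto simp: merge_def join_blocks_def)
qed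

lemma card_merge:
  assumes x: "x \<in> weighted_partitions n" and m: "mergeable x V W u"
  shows "Suc (card (merge x V W u)) = card x"
proof -
  have VW: "V \<in> x" "W \<in> x" "V \<noteq> W" using m by (auto simp: mergeable_def)
  then have "card {V, W} \<le> card x" using weighted_partitions_finite[OF x] by (intro card_mono) auto
  then show ?thesis
    using weighted_partitions_finite[OF x] join_blocks_notin[OF x m] VW
    by (simp add: merge_def card_Diff_subset)
qed

text \<open>What disappears from \<open>x\<close> is the merged pair, which the minima orient; what
  is new is the joined block, whose weight reveals \<open>u\<close>. This is what makes the definite
  description in \<open>wp_labeling\<close> well defined.\<close>

lemma merge_inject:
  assumes x: "x \<in> weighted_partitions n" and m: "mergeable x V W u" "mergeable x V' W' u'"
    and eq: "merge x V W u = merge x V' W' u'"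
  shows "V = V' \<and> W = W' \<and> u = u'"
proof -
  have "x - merge x V W u = {V, W}"
    using m(1) join_blocks_notin[OF x m(1)] by (auto simp: merge_def mergeable_def)
  moreover have "x - merge x V' W' u' = {V', W'}"
    using m(2) join_blocks_notin[OF x m(2)] by (auto simp: merge_def mergeable_def)
  ultimately have "{V, W} = {V', W'}" using eq by simp
  then have VW: "V = V'" "W = W'"
    using m by (auto simp: mergeable_def doubleton_eq_iff)
  have "merge x V W u - x = {join_blocks V W u}"
    using join_blocks_notin[OF x m(1)] unfolding merge_def by blast
  moreover have "merge x V' W' u' - x = {join_blocks V' W' u'}"
    using join_blocks_notin[OF x m(2)] unfolding merge_def by blast
  ultimately have "join_blocks V W u = join_blocks V W u'" using eq unfolding VW by simp
  then show ?thesis using VW by (simp add: join_blocks_def)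
qed

lemma wp_labeling_merge:
  assumes x: "x \<in> weighted_partitions n" and m: "mergeable x V W u"
  shows "wp_labeling x (merge x V W u) = (block_min V, block_min W, u)"
  unfolding wp_labeling_def merges_to_iff
proof (rule the_equality)
  fix l assume "\<exists>V' W' u'. (mergeable x V' W' u' \<and> merge x V W u = merge x V' W' u') \<and>
    l = (block_min V', block_min W', u')"
  then show "l = (block_min V, block_min W, u)" using merge_inject[OF x m] by blast
qed (use m in blast)

lemma wp_cover_iff:
  "(x, x') \<in> wp_cover n \<longleftrightarrow>
     x \<in> weighted_partitions n \<and> (\<exists>V W u. mergeable x V W u \<and> x' = merge x V W u)"
  unfolding wp_cover_def merges_to_iff using merge_weighted_partitions[of x n] by blast

section \<open>Refinement\<close>

definition subblocks :: "weighted_set set \<Rightarrow> nat set \<Rightarrow> weighted_set set" where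
  "subblocks x B = {V \<in> x. fst V \<subseteq> B}"

definition subweight :: "weighted_set set \<Rightarrow> nat set \<Rightarrow> nat" where
  "subweight x B = sum snd (subblocks x B)"

text \<open>Merging \<open>c\<close> blocks into one takes \<open>c - 1\<close> steps, each adding \<open>0\<close> or \<open>1\<close> to the total weight.\<close>

definition finer :: "weighted_set set \<Rightarrow> weighted_set set \<Rightarrow> bool" where
  "finer x y \<longleftrightarrow>
     (\<forall>V\<in>x. \<exists>B\<in>y. fst V \<subseteq> fst B) \<and>
     (\<forall>B\<in>y. subweight x (fst B) \<le> snd B \<and>
        snd B < subweight x (fst B) + card (subblocks x (fst B)))"

lemma subblocks_finite: "x \<in> weighted_partitions n \<Longrightarrow> finite (subblocks x B)"
  using weighted_partitions_finite by (auto simp: subblocks_def)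

lemma subblocks_self:
  assumes x: "x \<in> weighted_partitions n" and V: "V \<in> x"
  shows "subblocks x (fst V) = {V}"
proof -
  have "U = V" if "U \<in> x" "fst U \<subseteq> fst V" for U
    using that weighted_partitions_inter[OF x that(1) V] block_min_in[OF x that(1)] by blast
  with V show ?thesis by (auto simp: subblocks_def)
qed

lemma finer_refl: "x \<in> weighted_partitions n \<Longrightarrow> finer x x"
  by (auto simp: finer_def subweight_def subblocks_self)

lemma subblocks_merge:
  assumes "mergeable x V W u" "fst V \<subseteq> B \<longleftrightarrow> fst W \<subseteq> B"
  shows "subblocks (merge x V W u) B =
    (if fst V \<subseteq> B then insert (join_blocks V W u) (subblocks x B - {V, W}) else subblocks x B)"
  using assms by (auto simp: subblocks_def merge_def join_blocks_def)

lemma subblocks_merge_sums: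
  assumes x: "x \<in> weighted_partitions n" and m: "mergeable x V W u" and B: "fst V \<subseteq> B" "fst W \<subseteq> B"
  shows "subweight (merge x V W u) B = subweight x B + u"
    and "Suc (card (subblocks (merge x V W u) B)) = card (subblocks x B)"
proof -
  define S where "S = subblocks x B - {V, W}"
  have VW: "V \<noteq> W" "V \<notin> S" "W \<notin> S" "finite S" "join_blocks V W u \<notin> S"
    using m join_blocks_notin[OF x m] subblocks_finite[OF x]
    by (auto simp: mergeable_def S_def subblocks_def)
  have S: "subblocks x B = insert V (insert W S)"
    using m B by (auto simp: S_def subblocks_def mergeable_def)
  have S': "subblocks (merge x V W u) B = insert (join_blocks V W u) S"
    using subblocks_merge[OF m] B by (simp add: S_def)
  show "subweight (merge x V W u) B = subweight x B + u"
    using VW unfolding subweight_def S S' by (simp add: join_blocks_def)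
  show "Suc (card (subblocks (merge x V W u) B)) = card (subblocks x B)"
    using VW unfolding S S' by simp
qed

lemma finer_block:
  assumes y: "y \<in> weighted_partitions n" and r: "finer x y"
    and "V \<in> x" "B \<in> y" "i \<in> fst V" "i \<in> fst B"
  shows "fst V \<subseteq> fst B"
  using assms weighted_partitions_inter[OF y] unfolding finer_def by blast

text \<open>A merge inside \<open>B\<close> narrows the interval of weights that \<open>B\<close>
  may have, at one end: \<open>u = 0\<close> lowers the upper end, \<open>u = 1\<close> raises the
  lower end. The other blocks of \<open>y\<close> see the same sub-blocks as before, so the only new
  condition is the one at \<open>B\<close>.\<close>

lemma finer_merge_iff:
  assumes x: "x \<in> weighted_partitions n" and y: "y \<in> weighted_partitions n" and m: "mergeable x V W u"
  shows "finer (merge x V W u) y \<longleftrightarrow>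
    finer x y \<and> (\<exists>B\<in>y. fst V \<subseteq> fst B \<and> fst W \<subseteq> fst B \<and> subweight x (fst B) + u \<le> snd B \<and>
       Suc (snd B) < subweight x (fst B) + u + card (subblocks x (fst B)))"
    (is "?L \<longleftrightarrow> finer x y \<and> (\<exists>B\<in>y. ?P B)")
proof -
  have VW: "V \<in> x" "W \<in> x" "u \<le> 1" using m by (auto simp: mergeable_def)
  have ne: "fst V \<noteq> {}" "fst W \<noteq> {}" using weighted_partitions_block[OF x] VW by auto
  have other: "subblocks (merge x V W u) (fst B') = subblocks x (fst B')"
    if "B \<in> y" "B' \<in> y" "fst V \<subseteq> fst B" "fst W \<subseteq> fst B" "B' \<noteq> B" for B B'
  proof -
    have "\<not> fst V \<subseteq> fst B'" "\<not> fst W \<subseteq> fst B'"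
      using that ne weighted_partitions_inter[OF y that(1,2)] by blast+
    then show ?thesis using subblocks_merge[OF m] by simp
  qed
  show ?thesis
  proof
    assume L: ?L
    then obtain B where B: "B \<in> y" "fst (join_blocks V W u) \<subseteq> fst B"
      by (auto simp: finer_def merge_def)
    then have VWB: "fst V \<subseteq> fst B" "fst W \<subseteq> fst B" by (auto simp: join_blocks_def)
    note sums = subblocks_merge_sums[OF x m VWB]
    have LB: "subweight (merge x V W u) (fst B) \<le> snd B"
      "snd B < subweight (merge x V W u) (fst B) + card (subblocks (merge x V W u) (fst B))"
      using L B by (auto simp: finer_def)
    then have "?P B" using sums VWB by simp
    moreover have "finer x y"
      unfolding finer_def
    proof (intro conjI ballI)
      fix U assume "U \<in> x"
      show "\<exists>B\<in>y. fst U \<subseteq> fst B"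
      proof (cases "U = V \<or> U = W")
        case True with B VWB show ?thesis by auto
      next
        case False with \<open>U \<in> x\<close> L show ?thesis by (auto simp: finer_def merge_def)
      qed
    next
      fix B' assume B': "B' \<in> y"
      have "subweight x (fst B') \<le> snd B' \<and> snd B' < subweight x (fst B') + card (subblocks x (fst B'))"
      proof (cases "B' = B")
        case True with LB sums VW show ?thesis by simp
      next
        case False
        have "subblocks (merge x V W u) (fst B') = subblocks x (fst B')"
          by (rule other[OF B(1) B' VWB False])
        moreover have "subweight (merge x V W u) (fst B') \<le> snd B'"
          "snd B' < subweight (merge x V W u) (fst B') + card (subblocks (merge x V W u) (fst B'))"
          using L B' by (auto simp: finer_def)
        ultimately show ?thesis by (simp add: subweight_def)
      qed
      then show "subweight x (fst B') \<le> snd B'"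
        "snd B' < subweight x (fst B') + card (subblocks x (fst B'))" by auto
    qed
    ultimately show "finer x y \<and> (\<exists>B\<in>y. ?P B)" using B by blast
  next
    assume "finer x y \<and> (\<exists>B\<in>y. ?P B)"
    then obtain B where r: "finer x y" and B: "B \<in> y" and P: "?P B" by blast
    then have VWB: "fst V \<subseteq> fst B" "fst W \<subseteq> fst B" by auto
    note sums = subblocks_merge_sums[OF x m VWB]
    show ?L
      unfolding finer_def
    proof (intro conjI ballI)
      fix U assume "U \<in> merge x V W u"
      then have "U \<in> x \<or> fst U \<subseteq> fst B" using VWB by (auto simp: merge_def join_blocks_def)
      then show "\<exists>B\<in>y. fst U \<subseteq> fst B" using r B unfolding finer_def by blast
    next
      fix B' assume B': "B' \<in> y"
      have "subweight (merge x V W u) (fst B') \<le> snd B' \<and>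
        snd B' < subweight (merge x V W u) (fst B') + card (subblocks (merge x V W u) (fst B'))"
      proof (cases "B' = B")
        case True with P sums show ?thesis by simp
      next
        case False
        have "subblocks (merge x V W u) (fst B') = subblocks x (fst B')"
          by (rule other[OF B(1) B' VWB False])
        with r B' show ?thesis by (auto simp: finer_def subweight_def)
      qed
      then show "subweight (merge x V W u) (fst B') \<le> snd B'"
        "snd B' < subweight (merge x V W u) (fst B') + card (subblocks (merge x V W u) (fst B'))" by auto
    qed
  qed
qed

lemma subblocks_Union:
  assumes x: "x \<in> weighted_partitions n" and y: "y \<in> weighted_partitions n" and r: "finer x y"
    and B: "B \<in> y"
  shows "(\<Union>V\<in>subblocks x (fst B). fst V) = fst B"
proof
  show "fst B \<subseteq> (\<Union>V\<in>subblocks x (fst B). fst V)"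
  proof
    fix i assume i: "i \<in> fst B"
    then have "i \<in> {1..n}" using weighted_partitions_block(4)[OF y B] by blast
    then obtain V where V: "V \<in> x" "i \<in> fst V" using weighted_partitions_cover[OF x] by blast
    then have "fst V \<subseteq> fst B" using finer_block[OF y r V(1) B] i by blast
    with V show "i \<in> (\<Union>V\<in>subblocks x (fst B). fst V)" unfolding subblocks_def by blast
  qed
qed (auto simp: subblocks_def)

lemma weighted_partitions_subset_eq:
  assumes x: "x \<in> weighted_partitions n" and y: "y \<in> weighted_partitions n" and "y \<subseteq> x"
  shows "x = y"
proof -
  have "V \<in> y" if "V \<in> x" for V
  proof -
    have i: "block_min V \<in> fst V" by (rule block_min_in[OF x that])
    then have "block_min V \<in> {1..n}" using weighted_partitions_block(4)[OF x that] by blast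
    then obtain W where "W \<in> y" "block_min V \<in> fst W" using weighted_partitions_cover[OF y] by blast
    with i that assms weighted_partitions_inter[OF x] show ?thesis by blast
  qed
  with assms show ?thesis by blast
qed

text \<open>If every block of \<open>y\<close> had a single sub-block, the bounds in
  \<open>finer\<close> would leave only one possible weight, that of the sub-block, and
  \<open>x\<close> would be \<open>y\<close>.\<close>

lemma finer_proper:
  assumes x: "x \<in> weighted_partitions n" and y: "y \<in> weighted_partitions n" and r: "finer x y"
    and "x \<noteq> y"
  obtains B V W where "B \<in> y" "V \<in> subblocks x (fst B)" "W \<in> subblocks x (fst B)"
    "block_min V < block_min W"
proof -
  have "\<exists>B\<in>y. 2 \<le> card (subblocks x (fst B))"
  proof (rule ccontr)
    assume *: "\<not> ?thesis"
    have "y \<subseteq> x"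
    proof
      fix B assume B: "B \<in> y"
      have bounds: "subweight x (fst B) \<le> snd B" "snd B < subweight x (fst B) + card (subblocks x (fst B))"
        using r B by (auto simp: finer_def)
      with * B have "card (subblocks x (fst B)) = 1" by fastforce
      then obtain V where V: "subblocks x (fst B) = {V}" by (auto simp: card_1_singleton_iff)
      then have "fst V = fst B" using subblocks_Union[OF x y r B] by simp
      moreover have "snd V = snd B" using bounds V by (simp add: subweight_def)
      ultimately have "V = B" by (rule prod_eqI)
      with V show "B \<in> x" unfolding subblocks_def by blast
    qed
    with weighted_partitions_subset_eq[OF x y] \<open>x \<noteq> y\<close> show False by blast
  qed
  then obtain B where B: "B \<in> y" "2 \<le> card (subblocks x (fst B))" by blast
  then obtain V W where VW: "V \<in> subblocks x (fst B)" "W \<in> subblocks x (fst B)" "V \<noteq> W"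
    using card_ge_2_other by metis
  then have "block_min V \<noteq> block_min W"
    using block_min_inj[OF x, of V W] unfolding subblocks_def by blast
  then show ?thesis using that[OF B(1) VW(1,2)] that[OF B(1) VW(2,1)] by linarith
qed

section \<open>The increasing chain\<close>

text \<open>Pairs of numbers rather than of blocks: the joined block inherits the minimum of
  \<open>V\<close>, so a merge only deletes the pairs that mention the absorbed minimum and leaves
  all others as they are.\<close>

definition min_pairs :: "weighted_set set \<Rightarrow> weighted_set set \<Rightarrow> (nat \<times> nat) set" where
  "min_pairs x y =
     {(p, q). p \<in> block_min ` x \<and> q \<in> block_min ` x \<and> p < q \<and> (\<exists>B\<in>y. p \<in> fst B \<and> q \<in> fst B)}"

text \<open>In a tight block of \<open>y\<close> every remaining merge step has to add \<open>1\<close> to the weight.\<close>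

definition tight :: "weighted_set set \<Rightarrow> weighted_set set \<Rightarrow> nat \<Rightarrow> bool" where
  "tight x y p \<longleftrightarrow> (\<exists>B\<in>y. p \<in> fst B \<and>
     Suc (snd B) = subweight x (fst B) + card (subblocks x (fst B)))"

definition greedy_step ::
  "weighted_set set \<Rightarrow> weighted_set set \<Rightarrow> weighted_set \<Rightarrow> weighted_set \<Rightarrow> nat \<Rightarrow> bool" where
  "greedy_step x y V W u \<longleftrightarrow>
     V \<in> x \<and> W \<in> x \<and> (block_min V, block_min W) \<in> min_pairs x y \<and>
     (\<forall>s t. (s, t) \<in> min_pairs x y \<longrightarrow> block_min V < s \<or> block_min V = s \<and> block_min W \<le> t) \<and>
     u = of_bool (tight x y (block_min V))"

lemma greedy_step_mergeable: "greedy_step x y V W u \<Longrightarrow> mergeable x V W u"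
  by (auto simp: greedy_step_def mergeable_def min_pairs_def)

lemma greedy_step_unique:
  assumes x: "x \<in> weighted_partitions n"
    and g: "greedy_step x y V W u" "greedy_step x y V' W' u'"
  shows "V' = V \<and> W' = W \<and> u' = u"
proof -
  have "block_min V < block_min V' \<or> block_min V = block_min V' \<and> block_min W \<le> block_min W'"
    "block_min V' < block_min V \<or> block_min V' = block_min V \<and> block_min W' \<le> block_min W"
    using g unfolding greedy_step_def by blast+
  then have "block_min V' = block_min V" "block_min W' = block_min W" by linarith+
  moreover have "V \<in> x" "W \<in> x" "V' \<in> x" "W' \<in> x" using g unfolding greedy_step_def by blast+
  ultimately have "V' = V" "W' = W" using block_min_inj[OF x] by blast+
  with g show ?thesis unfolding greedy_step_def by simp
qed

lemma block_min_merge_image: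
  assumes x: "x \<in> weighted_partitions n" and m: "mergeable x V W u"
  shows "block_min ` merge x V W u = block_min ` x - {block_min W}"
proof -
  have VW: "V \<in> x" "W \<in> x" "block_min V \<noteq> block_min W" using m by (auto simp: mergeable_def)
  have "block_min ` (x - {W}) = block_min ` x - {block_min W}"
    using inj_on_image_set_diff[OF block_min_inj_on[OF x], of x "{W}"] VW(2) by simp
  moreover have "x - {W} = insert V (x - {V, W})" using VW by auto
  ultimately show ?thesis
    unfolding merge_def image_insert join_blocks_min[OF x m] by (metis image_insert)
qed

lemma min_pairs_merge:
  assumes x: "x \<in> weighted_partitions n" and m: "mergeable x V W u"
  shows "(s, t) \<in> min_pairs (merge x V W u) y \<longleftrightarrow>
    (s, t) \<in> min_pairs x y \<and> s \<noteq> block_min W \<and> t \<noteq> block_min W"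
  unfolding min_pairs_def block_min_merge_image[OF x m] mem_Collect_eq prod.case Diff_iff singleton_iff
  by blast

lemma min_pairs_self:
  assumes x: "x \<in> weighted_partitions n"
  shows "min_pairs x x = {}"
proof -
  have False if "V \<in> x" "W \<in> x" "B \<in> x" "block_min V < block_min W"
    "block_min V \<in> fst B" "block_min W \<in> fst B" for V W B
  proof -
    have "V = B" "W = B"
      using that weighted_partitions_inter[OF x _ that(3)] block_min_in[OF x] by blast+
    with that(4) show False by simp
  qed
  then show ?thesis unfolding min_pairs_def by blast
qed

lemma tight_iff:
  assumes y: "y \<in> weighted_partitions n" and B: "B \<in> y" "p \<in> fst B"
  shows "tight x y p \<longleftrightarrow> Suc (snd B) = subweight x (fst B) + card (subblocks x (fst B))"
  unfolding tight_def using B weighted_partitions_inter[OF y B(1) _ B(2)] by blast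

lemma min_pairsI:
  assumes x: "x \<in> weighted_partitions n"
    and "B \<in> y" "V \<in> subblocks x (fst B)" "W \<in> subblocks x (fst B)" "block_min V < block_min W"
  shows "(block_min V, block_min W) \<in> min_pairs x y"
proof -
  have VW: "V \<in> x" "fst V \<subseteq> fst B" "W \<in> x" "fst W \<subseteq> fst B"
    using assms by (auto simp: subblocks_def)
  then have "block_min V \<in> fst B" "block_min W \<in> fst B" using block_min_in[OF x] by blast+
  with assms VW show ?thesis unfolding min_pairs_def by blast
qed

lemma min_pairs_subblocks:
  assumes x: "x \<in> weighted_partitions n" and y: "y \<in> weighted_partitions n" and r: "finer x y"
    and VW: "V \<in> x" "W \<in> x" and mp: "(block_min V, block_min W) \<in> min_pairs x y"
  obtains B where "B \<in> y" "V \<in> subblocks x (fst B)" "W \<in> subblocks x (fst B)"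
    "2 \<le> card (subblocks x (fst B))"
proof -
  obtain B where B: "B \<in> y" "block_min V \<in> fst B" "block_min W \<in> fst B"
    and lt: "block_min V < block_min W"
    using mp by (auto simp: min_pairs_def)
  have "fst V \<subseteq> fst B" "fst W \<subseteq> fst B"
    using finer_block[OF y r VW(1) B(1) block_min_in[OF x VW(1)] B(2)]
      finer_block[OF y r VW(2) B(1) block_min_in[OF x VW(2)] B(3)] by auto
  then have in_B: "V \<in> subblocks x (fst B)" "W \<in> subblocks x (fst B)"
    using VW by (auto simp: subblocks_def)
  have "card {V, W} \<le> card (subblocks x (fst B))"
    using in_B by (intro card_mono subblocks_finite[OF x]) auto
  moreover have "V \<noteq> W" using lt by auto
  ultimately show ?thesis using that[OF B(1) in_B] by simp
qed

lemma greedy_step_exists: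
  assumes x: "x \<in> weighted_partitions n" and y: "y \<in> weighted_partitions n" and r: "finer x y"
    and "x \<noteq> y"
  obtains V W u where "greedy_step x y V W u"
proof -
  obtain B V W where BVW: "B \<in> y" "V \<in> subblocks x (fst B)" "W \<in> subblocks x (fst B)"
    "block_min V < block_min W"
    using finer_proper[OF x y r \<open>x \<noteq> y\<close>] by metis
  define p where "p = (LEAST p. \<exists>q. (p, q) \<in> min_pairs x y)"
  define q where "q = (LEAST q. (p, q) \<in> min_pairs x y)"
  have "\<exists>q. (p, q) \<in> min_pairs x y"
    unfolding p_def by (rule LeastI_ex) (use min_pairsI[OF x BVW] in blast)
  then have pq: "(p, q) \<in> min_pairs x y" unfolding q_def by (rule LeastI_ex)
  have least: "p < s \<or> p = s \<and> q \<le> t" if st: "(s, t) \<in> min_pairs x y" for s t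
  proof -
    have "p \<le> s" unfolding p_def by (rule Least_le) (use st in blast)
    moreover have "q \<le> t" if "p = s" unfolding q_def by (rule Least_le) (use st that in blast)
    ultimately show ?thesis by linarith
  qed
  from pq obtain V' W' where VW: "V' \<in> x" "W' \<in> x" "p = block_min V'" "q = block_min W'"
    by (auto simp: min_pairs_def)
  have "greedy_step x y V' W' (of_bool (tight x y p))"
    using pq least VW by (simp add: greedy_step_def)
  then show ?thesis by (rule that)
qed

lemma greedy_step_finer:
  assumes x: "x \<in> weighted_partitions n" and y: "y \<in> weighted_partitions n" and r: "finer x y"
    and g: "greedy_step x y V W u"
  shows "finer (merge x V W u) y"
proof -
  have VW: "V \<in> x" "W \<in> x" "(block_min V, block_min W) \<in> min_pairs x y"
    using g by (auto simp: greedy_step_def)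
  obtain B where B: "B \<in> y" "V \<in> subblocks x (fst B)" "W \<in> subblocks x (fst B)"
    "2 \<le> card (subblocks x (fst B))"
    using min_pairs_subblocks[OF x y r VW] by metis
  then have sub: "fst V \<subseteq> fst B" "fst W \<subseteq> fst B" by (auto simp: subblocks_def)
  then have "block_min V \<in> fst B" using block_min_in[OF x VW(1)] by blast
  then have "tight x y (block_min V) \<longleftrightarrow> Suc (snd B) = subweight x (fst B) + card (subblocks x (fst B))"
    by (rule tight_iff[OF y B(1)])
  then have u: "u = of_bool (Suc (snd B) = subweight x (fst B) + card (subblocks x (fst B)))"
    using g by (simp add: greedy_step_def)
  have bounds: "subweight x (fst B) \<le> snd B" "snd B < subweight x (fst B) + card (subblocks x (fst B))"
    using r B(1) by (auto simp: finer_def)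
  \<comment> \<open>With at least two sub-blocks, the weight of a tight block exceeds
    \<open>subweight x (fst B)\<close>, so adding \<open>1\<close> does not overshoot. A block that
    is not tight can still afford a step with \<open>u = 0\<close>.\<close>
  have "subweight x (fst B) + u \<le> snd B"
    "Suc (snd B) < subweight x (fst B) + u + card (subblocks x (fst B))"
    using u bounds B(4) by (auto simp: of_bool_def split: if_splits)
  with sub B(1) r show ?thesis
    unfolding finer_merge_iff[OF x y greedy_step_mergeable[OF g]] by blast
qed

lemma wp_Lambda_less_iff:
  assumes "1 \<le> p" "p < q" "q \<le> n" "u \<le> 1" "1 \<le> s" "s < t" "t \<le> n" "v \<le> 1"
  shows "strictly_below (wp_Lambda_le n) (p, q, u) (s, t, v) \<longleftrightarrow>
    p < s \<or> p = s \<and> q \<le> t \<and> u \<le> v \<and> (q, u) \<noteq> (t, v)"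
  using assms by (auto simp: strictly_below_def wp_Lambda_le_def wp_Gamma_le_def wp_Gamma_def)

lemma mergeable_label_bounds:
  assumes x: "x \<in> weighted_partitions n" and m: "mergeable x V W u"
  shows "1 \<le> block_min V" "block_min V < block_min W" "block_min W \<le> n" "u \<le> 1"
proof -
  have VW: "V \<in> x" "W \<in> x" and *: "block_min V < block_min W" "u \<le> 1"
    using m by (auto simp: mergeable_def)
  have "block_min V \<in> {1..n}" "block_min W \<in> {1..n}"
    using VW[THEN weighted_partitions_block(4)[OF x]] VW[THEN block_min_in[OF x]] by blast+
  with * show "1 \<le> block_min V" "block_min V < block_min W" "block_min W \<le> n" "u \<le> 1" by auto
qed

lemma wp_labeling_less_iff:
  assumes x: "x \<in> weighted_partitions n" "mergeable x V W u"
    and z: "z \<in> weighted_partitions n" "mergeable z V' W' u'"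
  shows "strictly_below (wp_Lambda_le n)
      (wp_labeling x (merge x V W u)) (wp_labeling z (merge z V' W' u')) \<longleftrightarrow>
    block_min V < block_min V' \<or> block_min V = block_min V' \<and> block_min W \<le> block_min W' \<and> u \<le> u' \<and>
    (block_min W, u) \<noteq> (block_min W', u')"
  unfolding wp_labeling_merge[OF x] wp_labeling_merge[OF z]
  by (rule wp_Lambda_less_iff) (use mergeable_label_bounds[OF x] mergeable_label_bounds[OF z] in auto)

text \<open>The second pair of minima was already available in \<open>x\<close> and differs from the
  first one because \<open>block_min W\<close> is gone, so it is lexicographically larger. If both
  merges go into the same block, tightness persists: a step with \<open>u = 1\<close> adds one to
  the weight and removes one sub-block. Hence the bit cannot fall back to \<open>0\<close>.\<close>

lemma greedy_steps_increasing:
  assumes x: "x \<in> weighted_partitions n" and y: "y \<in> weighted_partitions n" and r: "finer x y"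
    and g: "greedy_step x y V W u" and g': "greedy_step (merge x V W u) y V' W' u'"
  shows "strictly_below (wp_Lambda_le n) (wp_labeling x (merge x V W u))
    (wp_labeling (merge x V W u) (merge (merge x V W u) V' W' u'))"
proof -
  note m = greedy_step_mergeable[OF g] and m' = greedy_step_mergeable[OF g']
  note z = merge_weighted_partitions[OF x m]
  have "(block_min V', block_min W') \<in> min_pairs (merge x V W u) y"
    using g' by (simp add: greedy_step_def)
  then have mp: "(block_min V', block_min W') \<in> min_pairs x y" "block_min W' \<noteq> block_min W"
    by (auto simp: min_pairs_merge[OF x m])
  then have lex: "block_min V < block_min V' \<or> block_min V = block_min V' \<and> block_min W < block_min W'"
    using g unfolding greedy_step_def by (metis le_neq_implies_less)
  have "u \<le> u'" if eq: "block_min V = block_min V'"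
  proof -
    have VW: "V \<in> x" "W \<in> x" "(block_min V, block_min W) \<in> min_pairs x y"
      using g by (auto simp: greedy_step_def)
    obtain B where B: "B \<in> y" "V \<in> subblocks x (fst B)" "W \<in> subblocks x (fst B)"
      using min_pairs_subblocks[OF x y r VW] by metis
    then have sub: "fst V \<subseteq> fst B" "fst W \<subseteq> fst B" by (auto simp: subblocks_def)
    have "block_min V \<in> fst B" using block_min_in[OF x VW(1)] sub by blast
    note t = tight_iff[OF y B(1) this]
    show ?thesis
      using g g' eq subblocks_merge_sums[OF x m sub] t[of x] t[of "merge x V W u"]
      by (auto simp: greedy_step_def of_bool_def)
  qed
  then show ?thesis
    using lex unfolding wp_labeling_less_iff[OF x m z m'] by auto
qed

text \<open>An increasing chain cannot postpone the greedy step: the pair of minima that it merges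
  would still be available after the first step, with a label that is too small.\<close>

lemma greedy_stepI:
  assumes x: "x \<in> weighted_partitions n" and y: "y \<in> weighted_partitions n"
    and m: "mergeable x V W u" and r': "finer (merge x V W u) y"
    and lex: "\<And>s t. (s, t) \<in> min_pairs (merge x V W u) y \<Longrightarrow>
      block_min V < s \<or> block_min V = s \<and> block_min W < t"
    and bit: "\<And>t. (block_min V, t) \<in> min_pairs (merge x V W u) y \<Longrightarrow>
      u \<le> of_bool (tight (merge x V W u) y (block_min V))"
  shows "greedy_step x y V W u"
proof -
  define z where "z = merge x V W u"
  define p where "p = block_min V"
  define q where "q = block_min W"
  have VW: "V \<in> x" "W \<in> x" "p < q" "u \<le> 1" using m by (auto simp: mergeable_def p_def q_def)
  have z: "z \<in> weighted_partitions n" using merge_weighted_partitions[OF x m] by (simp add: z_def)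
  obtain B where B: "B \<in> y" "fst V \<subseteq> fst B" "fst W \<subseteq> fst B" "subweight x (fst B) + u \<le> snd B"
    "Suc (snd B) < subweight x (fst B) + u + card (subblocks x (fst B))"
    using r' unfolding finer_merge_iff[OF x y m] by blast
  note sums = subblocks_merge_sums[OF x m B(2,3)]
  have pB: "p \<in> fst B" "q \<in> fst B" 
    using VW(1,2)[THEN block_min_in[OF x]] B(2,3) unfolding p_def q_def by blast+
  have pq: "(p, q) \<in> min_pairs x y"
    using VW pB B(1) by (auto simp: min_pairs_def p_def q_def)
  have mp: "(s, t) \<in> min_pairs z y \<longleftrightarrow> (s, t) \<in> min_pairs x y \<and> s \<noteq> q \<and> t \<noteq> q" for s t
    unfolding z_def q_def by (rule min_pairs_merge[OF x m])
  have least: "p < s \<or> p = s \<and> q \<le> t" if st: "(s, t) \<in> min_pairs x y" for s t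
  proof (rule ccontr)
    assume *: "\<not> ?thesis"
    show False
    proof (cases "s = q \<or> t = q")
      case False
      then have "(s, t) \<in> min_pairs z y" using mp st by simp
      then show False using lex * by (fastforce simp: z_def p_def q_def)
    next
      case True
      with * VW(3) have tq: "t = q" "s < p" by auto
      obtain B' where B': "B' \<in> y" "s \<in> fst B'" "q \<in> fst B'" using st tq by (auto simp: min_pairs_def)
      then have "B' = B" using weighted_partitions_inter[OF y B'(1) B(1)] pB by blast
      \<comment> \<open>The merge destroys the pair \<open>(s, q)\<close>, but \<open>s\<close>,
        \<open>p\<close> and \<open>q\<close> lie in one block of \<open>y\<close>. So
        \<open>(s, p)\<close> survives in its place, and \<open>lex\<close> excludes it because
        \<open>s < p\<close>.\<close>
      then have "(s, p) \<in> min_pairs x y"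
        using st pq tq B' pB B(1) by (auto simp: min_pairs_def)
      then have "(s, p) \<in> min_pairs z y" using mp tq VW(3) by simp
      then show False using lex tq by (fastforce simp: z_def p_def q_def)
    qed
  qed
  have "u = of_bool (tight x y p)"
  proof (cases "tight x y p")
    case True
    then have "Suc (snd B) = subweight x (fst B) + card (subblocks x (fst B))"
      by (simp add: tight_iff[OF y B(1) pB(1)])
    with B(5) VW(4) True show ?thesis by simp
  next
    case False
    have "u = 0"
    proof (rule ccontr)
      assume "u \<noteq> 0"
      with VW(4) have u: "u = 1" by simp
      \<comment> \<open>If the merge were the last one inside \<open>B\<close>, adding
        \<open>1\<close> would mean that \<open>B\<close> is tight. So another sub-block
        \<open>U\<close> remains, with minimum above \<open>p\<close> by \<open>lex\<close>. The
        pair \<open>(p, block_min U)\<close> activates \<open>bit\<close>, which makes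
        \<open>B\<close> tight after the merge. As a step with \<open>u = 1\<close> leaves tightness
        unchanged, \<open>B\<close> was tight before.\<close>
      have "card (subblocks x (fst B)) \<noteq> 2"
        using False B(4,5) u by (auto simp: tight_iff[OF y B(1) pB(1)])
      moreover have "2 \<le> card (subblocks x (fst B))" using B(4,5) by linarith
      ultimately have "2 \<le> card (subblocks z (fst B))" using sums by (simp add: z_def)
      moreover have J: "join_blocks V W u \<in> subblocks z (fst B)"
        using B(2,3) by (simp add: z_def merge_def subblocks_def join_blocks_def)
      ultimately obtain U where U: "U \<in> subblocks z (fst B)" "U \<noteq> join_blocks V W u"
        using card_ge_2_other[of "subblocks z (fst B)" "join_blocks V W u"] by auto
      have Jmin: "block_min (join_blocks V W u) = p" using join_blocks_min[OF x m] by (simp add: p_def)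
      have "block_min U \<noteq> p"
        using block_min_inj[OF z, of U "join_blocks V W u"] U J Jmin unfolding subblocks_def by auto
      moreover have "\<not> block_min U < p"
      proof
        assume "block_min U < p"
        then have "(block_min U, p) \<in> min_pairs z y"
          using min_pairsI[OF z B(1) U(1) J] Jmin by simp
        with lex \<open>block_min U < p\<close> show False by (fastforce simp: z_def p_def)
      qed
      ultimately have "(p, block_min U) \<in> min_pairs z y"
        using min_pairsI[OF z B(1) J U(1)] Jmin by simp
      then have "u \<le> of_bool (tight z y p)" using bit by (simp add: z_def p_def)
      then have "tight z y p" using u by (cases "tight z y p") simp_all
      then have "Suc (snd B) = subweight z (fst B) + card (subblocks z (fst B))"
        by (simp add: tight_iff[OF y B(1) pB(1)])
      with False sums u show False by (simp add: tight_iff[OF y B(1) pB(1)] z_def)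
    qed
    with False show ?thesis by simp
  qed
  then show ?thesis
    using VW pq least by (simp add: greedy_step_def p_def q_def)
qed

text \<open>The inductive step of uniqueness. The step after the merge is greedy, so its pair is the
  least that is left, and a label below it satisfies both hypotheses of \<open>greedy_stepI\<close>.
  The second minima differ because \<open>block_min W\<close> no longer occurs.\<close>

lemma increasing_first_step_greedy:
  assumes x: "x \<in> weighted_partitions n" and y: "y \<in> weighted_partitions n"
    and m: "mergeable x V W u" and r': "finer (merge x V W u) y"
    and g: "greedy_step (merge x V W u) y V' W' u'"
    and less: "strictly_below (wp_Lambda_le n) (wp_labeling x (merge x V W u))
      (wp_labeling (merge x V W u) (merge (merge x V W u) V' W' u'))"
  shows "greedy_step x y V W u"
proof (rule greedy_stepI[OF x y m r'])
  note z = merge_weighted_partitions[OF x m] and m' = greedy_step_mergeable[OF g]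
  have "block_min W' \<noteq> block_min W"
    using g unfolding greedy_step_def min_pairs_merge[OF x m] by blast
  with less have less: "block_min V < block_min V' \<or>
      block_min V = block_min V' \<and> block_min W < block_min W' \<and> u \<le> u'"
    unfolding wp_labeling_less_iff[OF x m z m'] by auto
  have lex: "block_min V' < s \<or> block_min V' = s \<and> block_min W' \<le> t"
    if "(s, t) \<in> min_pairs (merge x V W u) y" for s t
    using g that unfolding greedy_step_def by blast
  show "block_min V < s \<or> block_min V = s \<and> block_min W < t"
    if "(s, t) \<in> min_pairs (merge x V W u) y" for s t
    using lex[OF that] less by linarith
  show "u \<le> of_bool (tight (merge x V W u) y (block_min V))"
    if "(block_min V, t) \<in> min_pairs (merge x V W u) y" for t
  proof -
    have "block_min V = block_min V'" "u \<le> u'" using lex[OF that] less by linarith+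
    with g show ?thesis by (simp add: greedy_step_def)
  qed
qed

text \<open>The base case of uniqueness: after the last merge no pair is available, so the
  hypotheses of \<open>greedy_stepI\<close> about remaining pairs are vacuous.\<close>

lemma last_step_greedy:
  assumes x: "x \<in> weighted_partitions n" and m: "mergeable x V W u"
  shows "greedy_step x (merge x V W u) V W u"
proof -
  note y = merge_weighted_partitions[OF x m]
  show ?thesis
    by (rule greedy_stepI[OF x y m finer_refl[OF y]]) (simp_all add: min_pairs_self[OF y])
qed

section \<open>The poset of weighted partitions\<close>

lemma wp_cover_finer:
  assumes "(x, z) \<in> wp_cover n" "y \<in> weighted_partitions n" "finer z y"
  shows "finer x y"
  using assms finer_merge_iff unfolding wp_cover_iff by blast

lemma wp_cover_card: "(x, z) \<in> wp_cover n \<Longrightarrow> Suc (card z) = card x"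
  unfolding wp_cover_iff using card_merge by blast

lemma wp_coverD: "(x, z) \<in> wp_cover n \<Longrightarrow> x \<in> weighted_partitions n \<and> z \<in> weighted_partitions n"
  by (simp add: wp_cover_def)

lemma wp_cover_rtrancl_card: "(x, y) \<in> (wp_cover n)\<^sup>* \<Longrightarrow> x = y \<or> card y < card x"
  by (induction rule: rtrancl_induct) (auto dest: wp_cover_card)

text \<open>A greedy step exists as long as \<open>y\<close> is not reached, and it never leaves the
  elements below \<open>y\<close>. So the construction of the increasing chain also shows that the
  bounds in \<open>finer\<close> suffice for reachability.\<close>

lemma finer_rtrancl:
  "x \<in> weighted_partitions n \<Longrightarrow> y \<in> weighted_partitions n \<Longrightarrow> finer x y \<Longrightarrow> (x, y) \<in> (wp_cover n)\<^sup>*"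
proof (induction "card x" arbitrary: x rule: less_induct)
  case less
  show ?case
  proof (cases "x = y")
    case False
    then obtain V W u where g: "greedy_step x y V W u" using greedy_step_exists less.prems by metis
    then have c: "(x, merge x V W u) \<in> wp_cover n"
      using greedy_step_mergeable less.prems(1) unfolding wp_cover_iff by blast
    then have "(merge x V W u, y) \<in> (wp_cover n)\<^sup>*"
      using less.hyps wp_cover_card[OF c] wp_coverD[OF c] less.prems greedy_step_finer[OF less.prems g]
      by simp
    with c show ?thesis by (rule converse_rtrancl_into_rtrancl)
  qed simp
qed

lemma wp_le_iff:
  "(x, y) \<in> wp_le n \<longleftrightarrow> x \<in> weighted_partitions n \<and> y \<in> weighted_partitions n \<and> finer x y"
proof -
  have "finer x y" if "(x, y) \<in> (wp_cover n)\<^sup>*" "y \<in> weighted_partitions n"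
    using that by (induction rule: converse_rtrancl_induct) (auto intro: finer_refl wp_cover_finer)
  then show ?thesis using finer_rtrancl by (auto simp: wp_le_def)
qed

definition singletons :: "nat \<Rightarrow> weighted_set set" where
  "singletons n = (\<lambda>i. ({i}, 0)) ` {1..n}"

lemma singletons_weighted_partitions: "singletons n \<in> weighted_partitions n"
  by (rule weighted_partitionsI) (auto simp: singletons_def)

lemma singletons_finer:
  assumes x: "x \<in> weighted_partitions n"
  shows "finer (singletons n) x"
  unfolding finer_def
proof (intro conjI ballI)
  fix V assume "V \<in> singletons n"
  then obtain i where i: "i \<in> {1..n}" "fst V = {i}" by (auto simp: singletons_def)
  obtain B where "B \<in> x" "i \<in> fst B" by (rule weighted_partitions_cover[OF x i(1)])
  with i show "\<exists>B\<in>x. fst V \<subseteq> fst B" by auto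
next
  fix B assume B: "B \<in> x"
  note b = weighted_partitions_block[OF x B]
  have sub: "subblocks (singletons n) (fst B) = (\<lambda>i. ({i}, 0)) ` fst B"
    using b(4) by (auto simp: subblocks_def singletons_def)
  then show "subweight (singletons n) (fst B) \<le> snd B"
    unfolding subweight_def sub by (subst sum.reindex) (auto simp: inj_on_def)
  have "card (subblocks (singletons n) (fst B)) = card (fst B)"
    unfolding sub by (rule card_image) (auto simp: inj_on_def)
  then show "snd B < subweight (singletons n) (fst B) + card (subblocks (singletons n) (fst B))"
    using b(3) by simp
qed

lemma weighted_partitions_card:
  assumes x: "x \<in> weighted_partitions n"
  shows "card x \<le> n" and "n \<ge> 1 \<Longrightarrow> card x \<ge> 1"
proof -
  have "card (singletons n) = n"
    unfolding singletons_def by (subst card_image) (auto simp: inj_on_def)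
  then show "card x \<le> n"
    using wp_cover_rtrancl_card
      [OF finer_rtrancl[OF singletons_weighted_partitions x singletons_finer[OF x]]] by auto
  show "card x \<ge> 1" if "n \<ge> 1"
  proof -
    have "1 \<in> {1..n}" using that by simp
    then obtain V where "V \<in> x" by (rule weighted_partitions_cover[OF x])
    then have "card x > 0" using weighted_partitions_finite[OF x] by (auto simp: card_gt_0_iff)
    then show ?thesis by simp
  qed
qed

lemma ranked_poset_weighted_partitions:
  assumes "n \<ge> 1"
  shows "ranked_poset (weighted_partitions n) (wp_le n) (singletons n) (\<lambda>x. n - card x) (n - 1)"
proof
  have "refl_on (weighted_partitions n) (wp_le n)"
    by (auto simp: refl_on_def wp_le_def)
  moreover have "trans (wp_le n)"
    by (rule transI) (auto simp: wp_le_def)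
  moreover have "antisym (wp_le n)"
    by (rule antisymI) (auto simp: wp_le_def dest!: wp_cover_rtrancl_card)
  ultimately show "partial_order_on (weighted_partitions n) (wp_le n)"
    by (auto simp: partial_order_on_def preorder_on_def wp_le_def)
  show "is_minimum (weighted_partitions n) (wp_le n) (singletons n)"
    by (simp add: is_minimum_def wp_le_iff singletons_weighted_partitions singletons_finer)
  show "n - card (singletons n) = 0"
    unfolding singletons_def by (subst card_image) (auto simp: inj_on_def)
  show "n - card x < n - card y" if "strictly_below (wp_le n) x y" for x y
  proof -
    have "card y < card x" using that wp_cover_rtrancl_card by (auto simp: strictly_below_def wp_le_def)
    moreover have "card x \<le> n" using that weighted_partitions_card by (auto simp: strictly_below_def wp_le_def)
    ultimately show ?thesis by linarith
  qed
  show "\<exists>z. strictly_below (wp_le n) x z \<and> (z, y) \<in> wp_le n \<and> n - card z = Suc (n - card x)"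
    if xy: "strictly_below (wp_le n) x y" for x y
  proof -
    have "(x, y) \<in> (wp_cover n)\<^sup>*" "x \<noteq> y" "y \<in> weighted_partitions n"
      using xy by (auto simp: strictly_below_def wp_le_def)
    then obtain z where z: "(x, z) \<in> wp_cover n" "(z, y) \<in> (wp_cover n)\<^sup>*"
      by (metis converse_rtranclE)
    have "card z < card x" "card x \<le> n" "n - card z = Suc (n - card x)"
      using wp_cover_card[OF z(1)] weighted_partitions_card(1)[of x n] wp_coverD[OF z(1)] by auto
    then have "strictly_below (wp_le n) x z" "(z, y) \<in> wp_le n" "n - card z = Suc (n - card x)"
      using z wp_coverD[OF z(1)] \<open>y \<in> weighted_partitions n\<close>
      by (auto simp: strictly_below_def wp_le_def)
    then show ?thesis by blast
  qed
  show "n - card x \<le> n - 1" if "x \<in> weighted_partitions n" for x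
    using weighted_partitions_card(2)[OF that assms] by linarith
  show "\<exists>y. strictly_below (wp_le n) x y" if x: "x \<in> weighted_partitions n" and "n - card x < n - 1" for x
  proof -
    have "2 \<le> card x" using that by linarith
    then obtain V W where VW: "V \<in> x" "W \<in> x" "V \<noteq> W"
      using card_ge_2_other by metis
    have *: "\<exists>y. strictly_below (wp_le n) x y" if "V \<in> x" "W \<in> x" "block_min V < block_min W" for V W
    proof -
      have "(x, merge x V W 0) \<in> wp_cover n"
        using that x unfolding wp_cover_iff mergeable_def by blast
      from wp_cover_card[OF this] wp_coverD[OF this] this
      have "strictly_below (wp_le n) x (merge x V W 0)"
        by (auto simp: strictly_below_def wp_le_def)
      then show ?thesis by blast
    qed
    have "block_min V \<noteq> block_min W" using block_min_inj[OF x] VW by blast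
    then show ?thesis using *[of V W] *[of W V] VW by (meson linorder_neqE_nat)
  qed
qed (simp add: finite_weighted_partitions)

text \<open>Every generating step lowers the number of blocks by exactly one, so nothing fits
  strictly between its ends.\<close>

lemma covers_wp_le: "covers (wp_le n) x z \<longleftrightarrow> (x, z) \<in> wp_cover n"
proof
  assume c: "covers (wp_le n) x z"
  then have "(x, z) \<in> (wp_cover n)\<^sup>*" "x \<noteq> z" by (auto simp: covers_def strictly_below_def wp_le_def)
  then obtain y where y: "(x, y) \<in> wp_cover n" "(y, z) \<in> (wp_cover n)\<^sup>*" by (metis converse_rtranclE)
  have "y = z"
  proof (rule ccontr)
    assume "y \<noteq> z"
    moreover have "x \<noteq> y" using wp_cover_card[OF y(1)] by auto
    moreover have "z \<in> weighted_partitions n" using c by (auto simp: covers_def strictly_below_def wp_le_def)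
    ultimately show False
      using c y wp_coverD[OF y(1)] by (auto simp: covers_def strictly_below_def wp_le_def)
  qed
  with y show "(x, z) \<in> wp_cover n" by simp
next
  assume xz: "(x, z) \<in> wp_cover n"
  have False if "strictly_below (wp_le n) x y" "strictly_below (wp_le n) y z" for y
    using that wp_cover_card[OF xz] wp_cover_rtrancl_card[of x y n] wp_cover_rtrancl_card[of y z n]
    by (auto simp: strictly_below_def wp_le_def)
  moreover have "strictly_below (wp_le n) x z"
    using xz wp_coverD[OF xz] wp_cover_card[OF xz] by (auto simp: strictly_below_def wp_le_def)
  ultimately show "covers (wp_le n) x z" by (auto simp: covers_def)
qed

section \<open>The labeling of weighted partitions\<close>

lemma partial_order_on_wp_Lambda: "partial_order_on (wp_Lambda n) (wp_Lambda_le n)"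
proof -
  have "wp_Lambda_le n \<subseteq> wp_Lambda n \<times> wp_Lambda n"
    by (auto simp: wp_Lambda_le_def wp_Lambda_def wp_Gamma_le_def wp_Gamma_def)
  moreover have "refl_on (wp_Lambda n) (wp_Lambda_le n)"
    by (auto simp: refl_on_def wp_Lambda_le_def wp_Lambda_def wp_Gamma_le_def wp_Gamma_def)
  moreover have "trans (wp_Lambda_le n)"
    unfolding trans_def wp_Lambda_le_def wp_Gamma_le_def wp_Gamma_def by auto
  moreover have "antisym (wp_Lambda_le n)"
    unfolding antisym_def wp_Lambda_le_def wp_Gamma_le_def wp_Gamma_def by auto
  ultimately show ?thesis by (simp add: partial_order_on_def preorder_on_def)
qed

lemma edge_labeling_wp:
  assumes "n \<ge> 1"
  shows "edge_labeling (weighted_partitions n) (wp_le n) (wp_Lambda n) (wp_Lambda_le n) wp_labeling"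
proof -
  interpret ranked_poset "weighted_partitions n" "wp_le n" "singletons n" "\<lambda>x. n - card x" "n - 1"
    by (rule ranked_poset_weighted_partitions[OF assms])
  have "wp_labeling x z \<in> wp_Lambda n" if "covers (wp_le n) x z" for x z
  proof -
    obtain V W u where x: "x \<in> weighted_partitions n" and m: "mergeable x V W u" "z = merge x V W u"
      using \<open>covers (wp_le n) x z\<close> by (auto simp: covers_wp_le wp_cover_iff)
    have "wp_labeling x z = (block_min V, block_min W, u)"
      unfolding m(2) by (rule wp_labeling_merge[OF x m(1)])
    with mergeable_label_bounds[OF x m(1)] show ?thesis by (auto simp: wp_Lambda_def wp_Gamma_def)
  qed
  then show ?thesis by (simp add: edge_labeling_def order partial_order_on_wp_Lambda)
qed

section \<open>Existence and uniqueness of increasing chains\<close>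

abbreviation wp_chains :: "nat \<Rightarrow> weighted_set set \<Rightarrow> weighted_set set \<Rightarrow> weighted_set set list set" where
  "wp_chains n \<equiv> interval_maximal_chains (weighted_partitions n) (wp_le n)"

abbreviation wp_increasing :: "nat \<Rightarrow> weighted_set set list \<Rightarrow> bool" where
  "wp_increasing n \<equiv> increasing_chain (wp_Lambda_le n) wp_labeling"

lemma wp_chain_ConsE:
  assumes "x # c \<in> wp_chains n x y" "x \<noteq> y \<or> c \<noteq> []"
  obtains V W u c' where "c = merge x V W u # c'" "mergeable x V W u" "x \<in> weighted_partitions n"
    "merge x V W u # c' \<in> wp_chains n (merge x V W u) y"
proof -
  have c: "c \<noteq> []" "covers (wp_le n) x (hd c)" "c \<in> wp_chains n (hd c) y" "x \<in> weighted_partitions n"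
    using assms by (auto simp: interval_maximal_chains_Cons split: if_splits)
  then obtain V W u where "mergeable x V W u" "hd c = merge x V W u"
    by (auto simp: covers_wp_le wp_cover_iff)
  with c that show ?thesis by (cases c) auto
qed

lemma wp_chain_Cons_merge:
  assumes "x \<in> weighted_partitions n" "mergeable x V W u" "c \<in> wp_chains n (merge x V W u) y"
  shows "x # c \<in> wp_chains n x y"
proof -
  have "c \<noteq> []" "hd c = merge x V W u"
    using assms(3) by (auto simp: interval_maximal_chains_def saturated_chain_def)
  moreover have "(x, merge x V W u) \<in> wp_cover n" using assms(1,2) unfolding wp_cover_iff by blast
  ultimately show ?thesis using assms(1,3) by (simp add: interval_maximal_chains_Cons covers_wp_le)
qed

lemma wp_chain_carrier: "c \<in> wp_chains n x y \<Longrightarrow> x \<in> weighted_partitions n \<and> y \<in> weighted_partitions n"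
  unfolding interval_maximal_chains_def saturated_chain_def
  using hd_in_set last_in_set by blast

lemma wp_chain_finer: "c \<in> wp_chains n x y \<Longrightarrow> finer x y"
proof (induction c arbitrary: x)
  case Nil
  then show ?case by (simp add: Nil_notin_interval_maximal_chains)
next
  case (Cons a c)
  have a: "a = x" and y: "y \<in> weighted_partitions n"
    using Cons.prems wp_chain_carrier[OF Cons.prems] by (auto simp: interval_maximal_chains_Cons)
  show ?case
  proof (cases "c = []")
    case True
    with Cons.prems show ?thesis by (auto simp: interval_maximal_chains_Cons finer_refl)
  next
    case False
    with Cons.prems a have "c \<in> wp_chains n (hd c) y" "(x, hd c) \<in> wp_cover n"
      by (auto simp: interval_maximal_chains_Cons covers_wp_le)
    with Cons.IH y show ?thesis using wp_cover_finer by blast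
  qed
qed

lemma increasing_chain_Cons_Cons:
  "increasing_chain le lam (x # z # c) \<longleftrightarrow>
     (c = [] \<or> strictly_below le (lam x z) (lam z (hd c))) \<and> increasing_chain le lam (z # c)"
  by (cases c) (simp_all add: increasing_chain_def label_sequence_Cons_Cons label_sequence_singleton)

text \<open>Induction from the upper end: the tail of an increasing chain is increasing, so it
  begins greedily, and this forces the step before it to be greedy as well.\<close>

lemma wp_increasing_first:
  "x # c \<in> wp_chains n x y \<Longrightarrow> wp_increasing n (x # c) \<Longrightarrow> x \<noteq> y \<Longrightarrow>
     \<exists>V W u c'. greedy_step x y V W u \<and> c = merge x V W u # c' \<and>
       merge x V W u # c' \<in> wp_chains n (merge x V W u) y"
proof (induction c arbitrary: x)
  case Nil
  then show ?case by (auto simp: interval_maximal_chains_Cons)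
next
  case (Cons z c)
  obtain V W u where m: "mergeable x V W u" and z: "z = merge x V W u" and x: "x \<in> weighted_partitions n"
    and c: "z # c \<in> wp_chains n z y"
    using wp_chain_ConsE[OF Cons.prems(1)] Cons.prems(3) by (metis list.inject)
  have y: "y \<in> weighted_partitions n" using wp_chain_carrier[OF c] by blast
  have inc: "wp_increasing n (z # c)" "c = [] \<or> strictly_below (wp_Lambda_le n) (wp_labeling x z) (wp_labeling z (hd c))"
    using Cons.prems(2) by (auto simp: increasing_chain_Cons_Cons)
  have "greedy_step x y V W u"
  proof (cases "z = y")
    case True
    then show ?thesis using last_step_greedy[OF x m] z by simp
  next
    case False
    then obtain V' W' u' c' where g: "greedy_step z y V' W' u'" "c = merge z V' W' u' # c'"
      using Cons.IH[OF c inc(1)] by blast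
    then have "strictly_below (wp_Lambda_le n) (wp_labeling x z) (wp_labeling z (merge z V' W' u'))"
      using inc(2) by simp
    then show ?thesis
      using increasing_first_step_greedy[OF x y m] wp_chain_finer[OF c] g(1) z by blast
  qed
  with z c show ?case by blast
qed

lemma wp_increasing_unique:
  "c \<in> wp_chains n x y \<Longrightarrow> wp_increasing n c \<Longrightarrow> d \<in> wp_chains n x y \<Longrightarrow> wp_increasing n d \<Longrightarrow> c = d"
proof (induction c arbitrary: x d)
  case Nil
  then show ?case by (simp add: Nil_notin_interval_maximal_chains)
next
  case (Cons a c)
  have a: "a = x" and x: "x \<in> weighted_partitions n"
    using Cons.prems(1) by (auto simp: interval_maximal_chains_Cons)
  obtain d' where d: "d = x # d'"
    using Cons.prems(3) by (cases d) (auto simp: Nil_notin_interval_maximal_chains interval_maximal_chains_Cons)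
  note c_chain = Cons.prems(1,2)[unfolded a] and d_chain = Cons.prems(3,4)[unfolded d]
  show ?case
  proof (cases "x = y")
    case True
    \<comment> \<open>Each merge loses a block, so no chain with at least one step can return to
      \<open>x\<close>.\<close>
    have "e = []" if e: "x # e \<in> wp_chains n x y" for e
    proof (rule ccontr)
      assume "e \<noteq> []"
      then obtain V W u e' where "mergeable x V W u" "merge x V W u # e' \<in> wp_chains n (merge x V W u) y"
        using wp_chain_ConsE[OF e] by metis
      then have "(x, merge x V W u) \<in> wp_cover n" "(merge x V W u, y) \<in> (wp_cover n)\<^sup>*"
        using x wp_chain_finer wp_chain_carrier finer_rtrancl unfolding wp_cover_iff by blast+
      then show False using wp_cover_card wp_cover_rtrancl_card True by fastforce
    qed
    with c_chain d_chain a d show ?thesis by blast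
  next
    case False
    obtain V W u c' where g: "greedy_step x y V W u" and c: "c = merge x V W u # c'"
      "merge x V W u # c' \<in> wp_chains n (merge x V W u) y"
      using wp_increasing_first[OF c_chain False] by blast
    obtain V' W' u' d'' where g': "greedy_step x y V' W' u'" and d': "d' = merge x V' W' u' # d''"
      "merge x V' W' u' # d'' \<in> wp_chains n (merge x V' W' u') y"
      using wp_increasing_first[OF d_chain False] by blast
    have "merge x V' W' u' = merge x V W u" using greedy_step_unique[OF x g g'] by simp
    moreover have "wp_increasing n c" "wp_increasing n d'"
      using c_chain(2) d_chain(2) unfolding c(1) d'(1) increasing_chain_Cons_Cons by blast+
    ultimately have "c = d'" using Cons.IH[of "merge x V W u" d'] c d' by simp
    then show ?thesis by (simp add: a d)
  qed
qed

lemma wp_increasing_exists: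
  "x \<in> weighted_partitions n \<Longrightarrow> y \<in> weighted_partitions n \<Longrightarrow> finer x y \<Longrightarrow>
     \<exists>c. c \<in> wp_chains n x y \<and> wp_increasing n c"
proof (induction "card x" arbitrary: x rule: less_induct)
  case less
  show ?case
  proof (cases "x = y")
    case True
    then have "[x] \<in> wp_chains n x y" "wp_increasing n [x]"
      using less.prems by (auto simp: interval_maximal_chains_Cons increasing_chain_def label_sequence_singleton)
    then show ?thesis by blast
  next
    case False
    then obtain V W u where g: "greedy_step x y V W u" using greedy_step_exists less.prems by metis
    note m = greedy_step_mergeable[OF g]
    define z where "z = merge x V W u"
    have z: "z \<in> weighted_partitions n" "finer z y" "card z < card x"
      using merge_weighted_partitions[OF less.prems(1) m] greedy_step_finer[OF less.prems g]
        card_merge[OF less.prems(1) m] by (auto simp: z_def)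
    then obtain c where c: "c \<in> wp_chains n z y" "wp_increasing n c"
      using less.hyps less.prems(2) by blast
    then obtain c' where c': "c = z # c'"
      by (cases c) (auto simp: Nil_notin_interval_maximal_chains interval_maximal_chains_Cons)
    \<comment> \<open>The chain \<open>c\<close> comes from the induction hypothesis without a
      description of its first step. That step is greedy by \<open>wp_increasing_first\<close>, so
      the two labels at the junction can be compared.\<close>
    have "c' = [] \<or> strictly_below (wp_Lambda_le n) (wp_labeling x z) (wp_labeling z (hd c'))"
    proof (cases "z = y")
      case True
      with c wp_increasing_unique[OF c, of "[z]"] c' z show ?thesis
        by (simp add: interval_maximal_chains_Cons increasing_chain_def label_sequence_singleton)
    next
      case False
      then obtain V' W' u' d where g': "greedy_step z y V' W' u'" "c' = merge z V' W' u' # d"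
        using wp_increasing_first[of z c' n y] c c' by blast
      then show ?thesis using greedy_steps_increasing[OF less.prems g, of V' W' u'] by (simp add: z_def)
    qed
    then have "wp_increasing n (x # c)" using c by (simp add: c' increasing_chain_Cons_Cons)
    moreover have "x # c \<in> wp_chains n x y"
      using wp_chain_Cons_merge[OF less.prems(1) m] c by (simp add: z_def)
    ultimately show ?thesis by blast
  qed
qed

section \<open>Label sequences and rank two switching\<close>

text \<open>In a given \<open>x\<close> the two minima in a label identify two blocks, and
  \<open>u\<close> fixes the new weight; so the label determines the next element of the chain. Both
  the condition on ascent-free chains and the uniqueness in rank two switching rest on this.\<close>

lemma label_sequence_wp_inject:
  "c \<in> wp_chains n x y \<Longrightarrow> d \<in> wp_chains n x y' \<Longrightarrow>
     label_sequence wp_labeling c = label_sequence wp_labeling d \<Longrightarrow> c = d"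
proof (induction c arbitrary: x d)
  case Nil
  then show ?case by (simp add: Nil_notin_interval_maximal_chains)
next
  case (Cons a c)
  have a: "a = x" using Cons.prems(1) by (auto simp: interval_maximal_chains_Cons)
  obtain d' where d: "d = x # d'"
    using Cons.prems(2) by (cases d) (auto simp: Nil_notin_interval_maximal_chains interval_maximal_chains_Cons)
  show ?case
  proof (cases "c = []")
    case True
    with Cons.prems(3) a d show ?thesis
      by (cases d') (simp_all add: label_sequence_Cons_Cons label_sequence_singleton)
  next
    case False
    then obtain V W u c' where c: "c = merge x V W u # c'" "mergeable x V W u" "x \<in> weighted_partitions n"
      "merge x V W u # c' \<in> wp_chains n (merge x V W u) y"
      using wp_chain_ConsE[of x c n y] Cons.prems(1) a by metis
    have "d' \<noteq> []"
      using Cons.prems(3) by (auto simp: a c(1) d label_sequence_Cons_Cons label_sequence_singleton)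
    then obtain V' W' u' d'' where d': "d' = merge x V' W' u' # d''" "mergeable x V' W' u'"
      "merge x V' W' u' # d'' \<in> wp_chains n (merge x V' W' u') y'"
      using wp_chain_ConsE[of x d' n y'] Cons.prems(2) d by metis
    have lab: "(block_min V, block_min W, u) = (block_min V', block_min W', u')"
      "label_sequence wp_labeling c = label_sequence wp_labeling d'"
      using Cons.prems(3) wp_labeling_merge[OF c(3) c(2)] wp_labeling_merge[OF c(3) d'(2)]
      by (auto simp: a d c(1) d'(1) label_sequence_Cons_Cons)
    have "V = V'" "W = W'"
      using lab block_min_inj[OF c(3)] c(2) d'(2) unfolding mergeable_def by blast+
    then have "merge x V' W' u' = merge x V W u" using lab(1) by simp
    then have "c = d'" using Cons.IH[of "merge x V W u" d'] c d' lab(2) by simp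
    then show ?thesis by (simp add: a d)
  qed
qed

text \<open>The labels could not be exchanged if \<open>W'\<close> were the block created by the
  first merge, since that merge must then come first to have its label; \<open>less\<close> excludes
  this. If \<open>V'\<close> is the created block, both merges enlarge \<open>V\<close>, and
  \<open>W'\<close> can be absorbed before \<open>W\<close>. Otherwise the two merges concern
  disjoint pairs of blocks.\<close>

lemma wp_commuting_merges:
  assumes x: "x \<in> weighted_partitions n" and m: "mergeable x V W u"
    and m': "mergeable (merge x V W u) V' W' u'"
    and less: "block_min V < block_min V' \<or> block_min V = block_min V' \<and> block_min W \<le> block_min W'"
  obtains P Q P' Q' where "mergeable x P Q u'" "block_min P = block_min V'" "block_min Q = block_min W'"
    "mergeable (merge x P Q u') P' Q' u" "block_min P' = block_min V" "block_min Q' = block_min W"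
    "merge (merge x P Q u') P' Q' u = merge (merge x V W u) V' W' u'"
proof -
  define J where "J = join_blocks V W u"
  have Jx: "J \<notin> x" and Jmin: "block_min J = block_min V"
    using join_blocks_notin[OF x m] join_blocks_min[OF x m] by (auto simp: J_def)
  have VW: "V \<in> x" "W \<in> x" "block_min V < block_min W" "u \<le> 1" using m by (auto simp: mergeable_def)
  have V'W': "V' \<in> merge x V W u" "W' \<in> merge x V W u" "block_min V' < block_min W'" "u' \<le> 1"
    using m' by (auto simp: mergeable_def)
  have "W' \<noteq> J" using V'W'(3) less Jmin by auto
  then have W': "W' \<in> x" "W' \<noteq> V" "W' \<noteq> W" using V'W'(2) by (auto simp: merge_def J_def)
  show ?thesis
  proof (cases "V' = J")
    case True
    define K where "K = join_blocks V W' u'"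
    have mP: "mergeable x V W' u'" using VW V'W' W' True Jmin by (simp add: mergeable_def)
    have Kx: "K \<notin> x" and Kmin: "block_min K = block_min V"
      using join_blocks_notin[OF x mP] join_blocks_min[OF x mP] by (auto simp: K_def)
    have mP': "mergeable (merge x V W' u') K W u"
      using VW W' Kmin by (auto simp: mergeable_def merge_def K_def)
    have "merge (merge x V W' u') K W u = insert (join_blocks K W u) (x - {V, W, W'})"
      using Kx unfolding merge_def K_def[symmetric] by blast
    moreover have "merge (merge x V W u) V' W' u' = insert (join_blocks J W' u') (x - {V, W, W'})"
      using Jx unfolding True merge_def J_def[symmetric] by blast
    moreover have "join_blocks K W u = join_blocks J W' u'"
      by (auto simp: join_blocks_def J_def K_def)
    ultimately have "merge (merge x V W' u') K W u = merge (merge x V W u) V' W' u'" by simp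
    then show ?thesis using that[OF mP _ _ mP'] True Jmin Kmin by simp
  next
    case False
    then have V': "V' \<in> x" "V' \<noteq> V" "V' \<noteq> W" using V'W'(1) by (auto simp: merge_def J_def)
    define K where "K = join_blocks V' W' u'"
    have mP: "mergeable x V' W' u'" using V' W' V'W' by (simp add: mergeable_def)
    have Kx: "K \<notin> x" using join_blocks_notin[OF x mP] by (simp add: K_def)
    have mP': "mergeable (merge x V' W' u') V W u"
      using VW V' W' by (auto simp: mergeable_def merge_def)
    have "merge (merge x V' W' u') V W u = insert J (insert K (x - {V, W, V', W'}))"
      using Kx VW unfolding merge_def K_def[symmetric] J_def[symmetric] by blast
    moreover have "merge (merge x V W u) V' W' u' = insert J (insert K (x - {V, W, V', W'}))"
      using Jx V' W' unfolding merge_def K_def[symmetric] J_def[symmetric] by blast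
    ultimately have "merge (merge x V' W' u') V W u = merge (merge x V W u) V' W' u'" by simp
    then show ?thesis using that[OF mP _ _ mP'] by simp
  qed
qed

lemma wp_rank_two_switching:
  "rank_two_switching (weighted_partitions n) (wp_le n) (wp_Lambda_le n) wp_labeling"
  unfolding rank_two_switching_def
proof (intro ballI allI impI)
  fix x y c a b
  assume x: "x \<in> weighted_partitions n" and c: "c \<in> wp_chains n x y"
    and inc: "wp_increasing n c" and lab: "label_sequence wp_labeling c = [a, b]"
  obtain c' where c': "c = x # c'"
    using c by (cases c) (auto simp: Nil_notin_interval_maximal_chains interval_maximal_chains_Cons)
  have "c' \<noteq> []" using lab c' by (auto simp: label_sequence_singleton)
  then obtain V W u d where d: "c' = merge x V W u # d" "mergeable x V W u"
    "merge x V W u # d \<in> wp_chains n (merge x V W u) y"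
    using wp_chain_ConsE[of x c' n y] c c' by metis
  define z where "z = merge x V W u"
  have z: "z \<in> weighted_partitions n" using merge_weighted_partitions[OF x d(2)] by (simp add: z_def)
  have "d \<noteq> []" using lab c' d by (auto simp: label_sequence_singleton label_sequence_Cons_Cons)
  then obtain V' W' u' e where e: "d = merge z V' W' u' # e" "mergeable z V' W' u'"
    "merge z V' W' u' # e \<in> wp_chains n (merge z V' W' u') y"
    using wp_chain_ConsE[of z d n y] d(3) unfolding z_def[symmetric] by metis
  have "e = []" using lab c' d e by (cases e) (auto simp: label_sequence_Cons_Cons)
  then have y: "y = merge z V' W' u'"
    using e(3) by (simp add: interval_maximal_chains_Cons)
  have ab: "a = (block_min V, block_min W, u)" "b = (block_min V', block_min W', u')"
    using lab wp_labeling_merge[OF x d(2)] wp_labeling_merge[OF z e(2)]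
    by (simp_all add: c' d(1) e(1) z_def label_sequence_Cons_Cons)
  have "strictly_below (wp_Lambda_le n) (wp_labeling x z) (wp_labeling z y)"
    using inc by (simp add: c' d(1) e(1) y z_def increasing_chain_Cons_Cons)
  then have less: "block_min V < block_min V' \<or> block_min V = block_min V' \<and> block_min W \<le> block_min W'"
    unfolding y z_def wp_labeling_less_iff[OF x d(2) z[unfolded z_def] e(2)[unfolded z_def]] by auto
  obtain P Q P' Q' where P: "mergeable x P Q u'" "block_min P = block_min V'" "block_min Q = block_min W'"
    and P': "mergeable (merge x P Q u') P' Q' u" "block_min P' = block_min V" "block_min Q' = block_min W"
    and eq: "merge (merge x P Q u') P' Q' u = y"
    unfolding y z_def
    by (rule wp_commuting_merges[OF x d(2) e(2)[unfolded z_def] less])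
  define z' where "z' = merge x P Q u'"
  have z': "z' \<in> weighted_partitions n" using merge_weighted_partitions[OF x P(1)] by (simp add: z'_def)
  have "[y] \<in> wp_chains n (merge z' P' Q' u) y"
    using merge_weighted_partitions[OF z', of P' Q' u] P'(1) eq
    by (simp add: interval_maximal_chains_Cons z'_def)
  then have "[z', y] \<in> wp_chains n z' y"
    using wp_chain_Cons_merge[OF z'] P'(1) by (simp add: z'_def)
  then have "[x, z', y] \<in> wp_chains n x y"
    using wp_chain_Cons_merge[OF x P(1)] by (simp add: z'_def)
  moreover have "label_sequence wp_labeling [x, z', y] = [b, a]"
    using wp_labeling_merge[OF x P(1)] wp_labeling_merge[OF z', of P' Q' u] P P' eq
    by (simp add: label_sequence_Cons_Cons label_sequence_singleton ab z'_def)
  ultimately show "\<exists>!d. d \<in> wp_chains n x y \<and> label_sequence wp_labeling d = [b, a]"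
    using label_sequence_wp_inject by (intro ex1I[of _ "[x, z', y]"]) metis+
qed

lemma EW_labeling_wp:
  assumes "n \<ge> 1"
  shows "EW_labeling (weighted_partitions n) (wp_le n) (wp_Lambda n) (wp_Lambda_le n) wp_labeling"
proof -
  interpret ranked_poset "weighted_partitions n" "wp_le n" "singletons n" "\<lambda>x. n - card x" "n - 1"
    by (rule ranked_poset_weighted_partitions[OF assms])
  have "\<exists>!c. c \<in> wp_chains n x y \<and> wp_increasing n c" if "(x, y) \<in> wp_le n" for x y
    using that wp_increasing_exists wp_increasing_unique unfolding wp_le_iff by metis
  moreover have "inj_on (label_sequence wp_labeling)
      {c \<in> wp_chains n x y. ascent_free_chain (wp_Lambda_le n) wp_labeling c}" for x y
    using label_sequence_wp_inject by (blast intro: inj_onI)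
  ultimately show ?thesis
    using graded_poset edge_labeling_wp[OF assms] wp_rank_two_switching
    by (simp add: EW_labeling_def ER_labeling_def)
qed

section \<open>Star forests and idempotent maps\<close>

definition stars :: "'a set \<Rightarrow> nat \<Rightarrow> 'a rel set" where
  "stars V j = {S. S \<subseteq> V \<times> V \<and> inj_on snd S \<and> fst ` S \<inter> snd ` S = {} \<and> card S = j}"

lemma finite_stars: "finite V \<Longrightarrow> finite (stars V j)"
  by (rule finite_subset[of _ "Pow (V \<times> V)"]) (auto simp: stars_def)

lemma card_stars_0: assumes "finite V" shows "card (stars V 0) = 1"
proof -
  have "stars V 0 = {{}}"
    using finite_subset[OF _ finite_cartesian_product[OF assms assms]] by (auto simp: stars_def)
  then show ?thesis by simp
qed

lemma card_stars_le:
  fixes V :: "'a set" and V' :: "'b set"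
  assumes V: "finite V" "finite V'" and h: "bij_betw h V V'"
  shows "card (stars V j) \<le> card (stars V' j)"
proof (rule card_inj_on_le[OF _ _ finite_stars[OF V(2)]])
  have h_inj: "inj_on h V" and h_im: "h ` V = V'" using h by (auto simp: bij_betw_def)
  have hh: "inj_on (map_prod h h) (V \<times> V)" using map_prod_inj_on[OF h_inj h_inj] .
  show "inj_on ((`) (map_prod h h)) (stars V j)"
    by (rule inj_on_subset[OF inj_on_image_Pow[OF hh]]) (auto simp: stars_def)
  show "(`) (map_prod h h) ` stars V j \<subseteq> stars V' j"
  proof clarify
    fix S assume "S \<in> stars V j"
    then have S: "S \<subseteq> V \<times> V" "inj_on snd S" "fst ` S \<inter> snd ` S = {}" "card S = j"
      by (auto simp: stars_def)
    have VS: "fst ` S \<subseteq> V" "snd ` S \<subseteq> V" using S(1) by auto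
    have images: "fst ` map_prod h h ` S = h ` fst ` S" "snd ` map_prod h h ` S = h ` snd ` S"
      by (simp_all add: image_image)
    have "inj_on (snd \<circ> map_prod h h) S"
      using comp_inj_on[OF S(2) inj_on_subset[OF h_inj VS(2)]] by (simp add: comp_def)
    then have "inj_on snd (map_prod h h ` S)" by (rule inj_on_imageI)
    moreover have "h ` fst ` S \<inter> h ` snd ` S = {}"
      using inj_on_image_Int[OF h_inj VS] S(3) by simp
    moreover have "card (map_prod h h ` S) = j"
      using card_image[OF inj_on_subset[OF hh S(1)]] S(4) by simp
    moreover have "map_prod h h ` S \<subseteq> V' \<times> V'" using S(1) h_im by auto
    ultimately show "map_prod h h ` S \<in> stars V' j" by (simp add: stars_def images)
  qed
qed

lemma card_stars_cong:
  assumes "finite V" "finite V'" "card V = card V'"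
  shows "card (stars V j) = card (stars V' j)"
proof -
  obtain h where h: "bij_betw h V V'" using finite_same_card_bij[OF assms] by blast
  show ?thesis
    using card_stars_le[OF assms(1,2) h] card_stars_le[OF assms(2,1) bij_betw_inv_into[OF h]]
    by (rule order_antisym)
qed

text \<open>A star forest as the map from each vertex to its centre. Isolated vertices, absent from
  an edge set, become fixed points with a fibre of their own, so that every block above
  \<open>x\<close> is the union of one fibre. The edge sets in \<open>stars\<close> are the form
  that can be united with a forest.\<close>

definition idempotents :: "'a set \<Rightarrow> nat \<Rightarrow> ('a \<Rightarrow> 'a) set" where
  "idempotents V j = {f \<in> V \<rightarrow>\<^sub>E V. (\<forall>v\<in>V. f (f v) = f v) \<and> card (f ` V) + j = card V}"

text \<open>The points that \<open>f\<close> moves, each paired with its image, are the edges. The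
  image of an idempotent map is its set of fixed points, so \<open>j\<close> counts the moved
  points.\<close>

lemma card_idempotents:
  assumes V: "finite V"
  shows "card (idempotents V j) = card (stars V j)"
proof -
  define g where "g f = (\<lambda>v. (f v, v)) ` {v \<in> V. f v \<noteq> v}" for f
  define k where "k S = (\<lambda>v\<in>V. if v \<in> snd ` S then THE p. (p, v) \<in> S else v)" for S :: "'a rel"
  have k_eq: "k S v = p" if "S \<subseteq> V \<times> V" "inj_on snd S" "(p, v) \<in> S" for S v p
  proof -
    have "(THE p. (p, v) \<in> S) = p"
    proof (rule the_equality)
      show "q = p" if "(q, v) \<in> S" for q
        using inj_onD[OF \<open>inj_on snd S\<close>, of "(q, v)" "(p, v)"] that \<open>(p, v) \<in> S\<close> by simp
    qed (rule that(3))
    moreover have "v \<in> V" "v \<in> snd ` S" using that by force+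
    ultimately show ?thesis by (simp add: k_def)
  qed
  have "bij_betw g (idempotents V j) (stars V j)"
  proof (rule bij_betw_byWitness[where f' = k])
    show "\<forall>f\<in>idempotents V j. k (g f) = f"
    proof
      fix f assume f: "f \<in> idempotents V j"
      show "k (g f) = f"
      proof
        fix v
        have gf: "g f \<subseteq> V \<times> V" "inj_on snd (g f)" using f by (auto simp: g_def idempotents_def inj_on_def)
        show "k (g f) v = f v"
        proof (cases "v \<in> V")
          case True
          show ?thesis
          proof (cases "f v = v")
            case True
            then have "v \<notin> snd ` g f" by (auto simp: g_def)
            with True \<open>v \<in> V\<close> show ?thesis by (simp add: k_def)
          next
            case False
            then have "(f v, v) \<in> g f" using \<open>v \<in> V\<close> by (simp add: g_def)
            then show ?thesis by (rule k_eq[OF gf])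
          qed
        next
          case False
          with f show ?thesis by (auto simp: k_def idempotents_def PiE_def extensional_def)
        qed
      qed
    qed
    show "\<forall>S\<in>stars V j. g (k S) = S"
    proof
      fix S assume "S \<in> stars V j"
      then have S: "S \<subseteq> V \<times> V" "inj_on snd S" "fst ` S \<inter> snd ` S = {}" by (auto simp: stars_def)
      show "g (k S) = S"
      proof
        show "g (k S) \<subseteq> S"
        proof
          fix e assume "e \<in> g (k S)"
          then obtain v where v: "e = (k S v, v)" "v \<in> V" "k S v \<noteq> v" by (auto simp: g_def)
          have "v \<in> snd ` S" using v(2,3) by (cases "v \<in> snd ` S") (simp_all add: k_def)
          then obtain p where "(p, v) \<in> S" by auto
          with k_eq[OF S(1,2)] v show "e \<in> S" by simp
        qed
        show "S \<subseteq> g (k S)"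
        proof
          fix e assume e: "e \<in> S"
          obtain p v where pv: "e = (p, v)" by (cases e)
          have "p \<in> fst ` S" "v \<in> snd ` S" using e pv by force+
          then have "p \<noteq> v" using S(3) by blast
          then show "e \<in> g (k S)"
            using k_eq[OF S(1,2)] e pv S(1) by (auto simp: g_def)
        qed
      qed
    qed
    show "g ` idempotents V j \<subseteq> stars V j"
    proof clarify
      fix f assume "f \<in> idempotents V j"
      then have f: "\<And>v. v \<in> V \<Longrightarrow> f v \<in> V" "\<And>v. v \<in> V \<Longrightarrow> f (f v) = f v" "card (f ` V) + j = card V"
        by (auto simp: idempotents_def)
      have "f ` V = {v \<in> V. f v = v}" using f(1,2) by force
      moreover have "card V = card {v \<in> V. f v = v} + card {v \<in> V. f v \<noteq> v}"
        using V by (subst card_Un_disjoint[symmetric]) (auto intro: arg_cong[where f = card])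
      moreover have "card (g f) = card {v \<in> V. f v \<noteq> v}"
        unfolding g_def by (rule card_image) (auto simp: inj_on_def)
      ultimately have "card (g f) = j" using f(3) by simp
      moreover have "fst ` g f \<inter> snd ` g f = {}" using f(2) by (auto simp: g_def)
      ultimately show "g f \<in> stars V j" using f(1) by (auto simp: stars_def g_def inj_on_def)
    qed
    show "k ` stars V j \<subseteq> idempotents V j"
    proof clarify
      fix S assume "S \<in> stars V j"
      then have S: "S \<subseteq> V \<times> V" "inj_on snd S" "fst ` S \<inter> snd ` S = {}" "card S = j"
        by (auto simp: stars_def)
      have fixed: "k S v = v" if "v \<in> V" "v \<notin> snd ` S" for v using that by (simp add: k_def)
      have moved: "k S v \<in> V - snd ` S" if v: "v \<in> V" for v
      proof (cases "v \<in> snd ` S")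
        case True
        then obtain p where p: "(p, v) \<in> S" by auto
        then have "p \<in> fst ` S" "p \<in> V" using S(1) by force+
        with S(3) k_eq[OF S(1,2) p] show ?thesis by auto
      qed (use v fixed in auto)
      have "k S ` V = V - snd ` S" using moved fixed by force
      moreover have "card (snd ` S) = j" using card_image[OF S(2)] S(4) by simp
      moreover have "snd ` S \<subseteq> V" using S(1) by auto
      ultimately have "card (k S ` V) + j = card V"
        using V card_mono[of V "snd ` S"] by (simp add: card_Diff_subset finite_subset)
      moreover have "k S (k S v) = k S v" if "v \<in> V" for v using moved[OF that] fixed by simp
      moreover have "k S \<in> V \<rightarrow>\<^sub>E V" using moved by (auto simp: k_def)
      ultimately show "k S \<in> idempotents V j" by (simp add: idempotents_def)
    qed
  qed
  then show ?thesis by (rule bij_betw_same_card)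
qed

section \<open>Counting the weighted partitions above a given one\<close>

text \<open>A numbering of \<open>C\<close> from \<open>0\<close> that depends on \<open>C\<close>
  alone. This independence from the map \<open>f\<close> is what lets the root be read back from the
  weight.\<close>

definition position :: "weighted_set set \<Rightarrow> weighted_set \<Rightarrow> nat" where
  "position C r = card {v \<in> C. block_min v < block_min r}"

lemma position_bij:
  assumes C: "finite C" and inj: "inj_on (\<lambda>v. block_min v) C"
  shows "bij_betw (position C) C {..<card C}"
proof -
  have mono: "position C r < position C s" if "r \<in> C" "s \<in> C" "block_min r < block_min s" for r s
    unfolding position_def by (rule psubset_card_mono) (use C that in auto)
  have "inj_on (position C) C"
  proof (rule inj_onI)
    fix r s assume rs: "r \<in> C" "s \<in> C" "position C r = position C s"
    then have "block_min r = block_min s" using mono[of r s] mono[of s r] by linarith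
    with inj rs show "r = s" by (auto dest: inj_onD)
  qed
  moreover have "position C ` C \<subseteq> {..<card C}"
  proof clarify
    fix r assume "r \<in> C"
    then show "position C r < card C"
      unfolding position_def by (intro psubset_card_mono[OF C]) auto
  qed
  ultimately show ?thesis
    by (metis bij_betw_def card_image card_lessThan card_subset_eq finite_lessThan)
qed

text \<open>The root of a star fixes, through its position among the blocks of the star, how many of
  the merge steps inside the star add \<open>1\<close> to the weight.\<close>

definition star_block :: "weighted_set set \<Rightarrow> (weighted_set \<Rightarrow> weighted_set) \<Rightarrow> weighted_set \<Rightarrow> weighted_set" where
  "star_block x f r =
     (let C = {v \<in> x. f v = r} in (\<Union>v\<in>C. fst v, sum snd C + position C r))"

context
  fixes x n
  assumes x: "x \<in> weighted_partitions n"
begin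

lemma position_subset_bij: "C \<subseteq> x \<Longrightarrow> bij_betw (position C) C {..<card C}"
  by (rule position_bij)
    (auto intro: finite_subset[OF _ weighted_partitions_finite[OF x]] inj_on_subset[OF block_min_inj_on[OF x]])

text \<open>The fibre is recovered from the block without knowing \<open>f\<close>; the weight of
  the block can then be decoded inside it.\<close>

lemma subblocks_star_block: "subblocks x (fst (star_block x f r)) = {v \<in> x. f v = r}"
proof -
  have "f v = r" if v: "v \<in> x" "fst v \<subseteq> (\<Union>v\<in>{v \<in> x. f v = r}. fst v)" for v
  proof -
    obtain w where w: "w \<in> x" "f w = r" "block_min v \<in> fst w" using v block_min_in[OF x v(1)] by blast
    then have "v = w" using weighted_partitions_inter[OF x v(1) w(1) block_min_in[OF x v(1)]] by blast
    with w show ?thesis by simp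
  qed
  then show ?thesis by (auto simp: subblocks_def star_block_def Let_def)
qed

lemma star_block_weight: "snd (star_block x f r) =
    subweight x (fst (star_block x f r)) + position (subblocks x (fst (star_block x f r))) r"
  unfolding subweight_def subblocks_star_block by (simp add: star_block_def Let_def)

lemma star_blocks_weighted_partition:
  assumes f: "f \<in> idempotents x j"
  shows "star_block x f ` f ` x \<in> weighted_partitions n" (is ?wp)
    and "finer x (star_block x f ` f ` x)" (is ?ref)
    and "card (star_block x f ` f ` x) + j = card x" (is ?card)
proof -
  have fx: "\<And>v. v \<in> x \<Longrightarrow> f v \<in> x" "\<And>v. v \<in> x \<Longrightarrow> f (f v) = f v" "card (f ` x) + j = card x"
    using f by (auto simp: idempotents_def)
  have fin: "finite {v \<in> x. f v = r}" for r using weighted_partitions_finite[OF x] by simp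
  have fst_block: "fst (star_block x f r) = (\<Union>v\<in>{v \<in> x. f v = r}. fst v)" for r
    by (simp add: star_block_def Let_def)
  have inj: "inj_on (star_block x f) (f ` x)"
  proof (rule inj_onI)
    fix r s assume r: "r \<in> f ` x" and eq: "star_block x f r = star_block x f s"
    from r have "r \<in> {v \<in> x. f v = r}" using fx by auto
    also have "\<dots> = {v \<in> x. f v = s}" using subblocks_star_block[of f] eq by metis
    finally show "r = s" using r fx by auto
  qed
  then show ?card using fx(3) by (simp add: card_image)
  have pos: "position {v \<in> x. f v = r} r < card {v \<in> x. f v = r}" if "r \<in> f ` x" for r
  proof -
    have "r \<in> {v \<in> x. f v = r}" using that fx by auto
    moreover have "{v \<in> x. f v = r} \<subseteq> x" by blast
    ultimately show ?thesis using bij_betwE[OF position_subset_bij] by blast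
  qed
  show ?wp
  proof (rule weighted_partitionsI)
    fix V assume "V \<in> star_block x f ` f ` x"
    then obtain r where r: "r \<in> f ` x" and V: "V = star_block x f r" by blast
    define C where "C = {v \<in> x. f v = r}"
    have C: "C \<subseteq> x" "finite C" "r \<in> C" using fin r fx by (auto simp: C_def)
    have V_eq: "fst V = (\<Union>v\<in>C. fst v)" "snd V = sum snd C + position C r"
      by (simp_all add: V star_block_def C_def Let_def)
    have blocks: "finite (fst v)" "fst v \<noteq> {}" "snd v < card (fst v)" if "v \<in> C" for v
      using weighted_partitions_block[OF x, of v] that C(1) by auto
    have "card (fst V) = (\<Sum>v\<in>C. card (fst v))"
      unfolding V_eq
    proof (rule card_UN_disjoint[OF C(2)])
      show "\<forall>v\<in>C. finite (fst v)" using blocks by blast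
      show "\<forall>v\<in>C. \<forall>w\<in>C. v \<noteq> w \<longrightarrow> fst v \<inter> fst w = {}"
        using weighted_partitions_inter[OF x] C(1) by blast
    qed
    \<comment> \<open>Each sub-block has a size exceeding its weight by at least one. Summed over
      \<open>C\<close>, this makes room for the position, which is below
      \<open>card C\<close>.\<close>
    moreover have "(\<Sum>v\<in>C. snd v + 1) \<le> (\<Sum>v\<in>C. card (fst v))"
      by (rule sum_mono) (use blocks in fastforce)
    moreover have "(\<Sum>v\<in>C. snd v + 1) = sum snd C + card C"
      unfolding sum.distrib by simp
    moreover have "position C r < card C" using pos[OF r] by (simp add: C_def)
    ultimately have "snd V < card (fst V)" unfolding V_eq(2) by linarith
    moreover from this have "fst V \<noteq> {}" by auto
    moreover have "finite (fst V)" unfolding V_eq(1) using C(2) blocks(1) by (rule finite_UN_I)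
    ultimately show "finite (fst V) \<and> fst V \<noteq> {} \<and> snd V < card (fst V)" by blast
  next
    fix V W i
    assume "V \<in> star_block x f ` f ` x" "W \<in> star_block x f ` f ` x" and i: "i \<in> fst V" "i \<in> fst W"
    then obtain r s where rs: "V = star_block x f r" "W = star_block x f s" by blast
    obtain v where v: "v \<in> x" "f v = r" "i \<in> fst v" using i(1) by (auto simp: rs fst_block)
    obtain w where w: "w \<in> x" "f w = s" "i \<in> fst w" using i(2) by (auto simp: rs fst_block)
    have "v = w" by (rule weighted_partitions_inter[OF x v(1) w(1) v(3) w(3)])
    with v w rs show "V = W" by simp
  next
    have "(\<Union>V\<in>star_block x f ` f ` x. fst V) = (\<Union>v\<in>x. fst v)" by (auto simp: fst_block)
    also have "\<dots> = {1..n}" using x by (auto simp: weighted_partitions_def partition_on_def)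
    finally show "(\<Union>V\<in>star_block x f ` f ` x. fst V) = {1..n}" .
  qed
  show ?ref
    unfolding finer_def
  proof (intro conjI ballI)
    fix v assume v: "v \<in> x"
    then have "fst v \<subseteq> fst (star_block x f (f v))" by (auto simp: fst_block)
    with v show "\<exists>B\<in>star_block x f ` f ` x. fst v \<subseteq> fst B" by blast
  next
    fix B assume "B \<in> star_block x f ` f ` x"
    then obtain r where r: "r \<in> f ` x" and B: "B = star_block x f r" by blast
    show "subweight x (fst B) \<le> snd B" "snd B < subweight x (fst B) + card (subblocks x (fst B))"
      using pos[OF r] unfolding B star_block_weight by (simp_all add: subblocks_star_block)
  qed
qed

text \<open>Each block shows its fibre through its sub-blocks and the root of the fibre through its
  excess weight; together they give \<open>f\<close>.\<close>

lemma star_blocks_inj: "inj_on (\<lambda>f. star_block x f ` f ` x) (idempotents x j)"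
proof (rule inj_onI)
  fix f g assume f: "f \<in> idempotents x j" and g: "g \<in> idempotents x j"
    and eq: "star_block x f ` f ` x = star_block x g ` g ` x"
  have fx: "\<And>v. v \<in> x \<Longrightarrow> f v \<in> x" "\<And>v. v \<in> x \<Longrightarrow> f (f v) = f v"
    and gx: "\<And>v. v \<in> x \<Longrightarrow> g v \<in> x" "\<And>v. v \<in> x \<Longrightarrow> g (g v) = g v"
    using f g by (auto simp: idempotents_def)
  have "f v = g v" if v: "v \<in> x" for v
  proof -
    have "star_block x f (f v) \<in> star_block x g ` g ` x" using v eq by blast
    then obtain s where s: "s \<in> g ` x" and B: "star_block x f (f v) = star_block x g s" by blast
    define C where "C = subblocks x (fst (star_block x g s))"
    have Cf: "C = {w \<in> x. f w = f v}" unfolding C_def B[symmetric] by (rule subblocks_star_block)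
    have Cg: "C = {w \<in> x. g w = s}" unfolding C_def by (rule subblocks_star_block)
    have "position C (f v) = position C s"
      using star_block_weight[of f "f v"] star_block_weight[of g s] unfolding B C_def[symmetric] by simp
    moreover have "f v \<in> C" unfolding Cf using v fx by simp
    moreover have "s \<in> C" unfolding Cg using s gx by auto
    moreover have "inj_on (position C) C"
      using position_subset_bij[of C] unfolding Cf bij_betw_def by simp
    ultimately have "f v = s" by (auto dest: inj_onD)
    moreover have "v \<in> C" unfolding Cf using v by simp
    ultimately show "f v = g v" unfolding Cg by simp
  qed
  then show "f = g" using f g by (auto simp: idempotents_def intro: PiE_ext)
qed

lemma star_blocks_surj:
  assumes y: "y \<in> weighted_partitions n" and r: "finer x y" and j: "card y + j = card x"
  obtains f where "f \<in> idempotents x j" "star_block x f ` f ` x = y"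
proof -
  have "\<forall>B\<in>y. \<exists>s. s \<in> subblocks x (fst B) \<and> subweight x (fst B) + position (subblocks x (fst B)) s = snd B"
  proof
    fix B assume "B \<in> y"
    then have B: "subweight x (fst B) \<le> snd B" "snd B < subweight x (fst B) + card (subblocks x (fst B))"
      using r by (auto simp: finer_def)
    have "subblocks x (fst B) \<subseteq> x" by (auto simp: subblocks_def)
    from position_subset_bij[OF this]
    have "position (subblocks x (fst B)) ` subblocks x (fst B) = {..<card (subblocks x (fst B))}"
      by (rule bij_betw_imp_surj_on)
    \<comment> \<open>The excess weight lies in the range of \<open>position\<close> by the bounds
      in \<open>finer\<close>; the sub-block at that position becomes the root.\<close>
    moreover have "snd B - subweight x (fst B) \<in> {..<card (subblocks x (fst B))}" using B by auto
    ultimately obtain s where "s \<in> subblocks x (fst B)"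
      "position (subblocks x (fst B)) s = snd B - subweight x (fst B)"
      by (metis imageE)
    with B(1) have "s \<in> subblocks x (fst B) \<and>
        subweight x (fst B) + position (subblocks x (fst B)) s = snd B" by simp
    then show "\<exists>s. s \<in> subblocks x (fst B) \<and>
        subweight x (fst B) + position (subblocks x (fst B)) s = snd B" by blast
  qed
  then obtain R where R: "\<And>B. B \<in> y \<Longrightarrow> R B \<in> subblocks x (fst B)"
    "\<And>B. B \<in> y \<Longrightarrow> subweight x (fst B) + position (subblocks x (fst B)) (R B) = snd B"
    by metis
  obtain b where b: "\<And>v. v \<in> x \<Longrightarrow> b v \<in> y" "\<And>v. v \<in> x \<Longrightarrow> fst v \<subseteq> fst (b v)"
    using r unfolding finer_def by metis
  have b_unique: "b v = B" if "B \<in> y" "v \<in> subblocks x (fst B)" for B v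
  proof -
    have v: "v \<in> x" "fst v \<subseteq> fst B" using that(2) by (auto simp: subblocks_def)
    then show ?thesis
      using weighted_partitions_inter[OF y b(1) that(1), of v "block_min v"] b(2)[OF v(1)]
        block_min_in[OF x v(1)] by blast
  qed
  define f where "f = (\<lambda>v\<in>x. R (b v))"
  have Rx: "R B \<in> x" if "B \<in> y" for B using R(1)[OF that] by (auto simp: subblocks_def)
  have f: "f v = R (b v)" "f v \<in> x" if "v \<in> x" for v using that Rx b by (auto simp: f_def)
  have fR: "f (R B) = R B" if "B \<in> y" for B
    using f(1)[OF Rx[OF that]] b_unique[OF that R(1)[OF that]] by simp
  have fib: "{v \<in> x. f v = R B} = subblocks x (fst B)" if B: "B \<in> y" for B
  proof -
    have "b v = B" if v: "v \<in> x" "f v = R B" for v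
      using b_unique[OF b(1)[OF v(1)] R(1)[OF b(1)[OF v(1)]]] b_unique[OF B R(1)[OF B]] f(1)[OF v(1)] v(2)
      by simp
    moreover have "v \<in> x \<and> f v = R B" if "v \<in> subblocks x (fst B)" for v
    proof -
      have "v \<in> x" using that by (simp add: subblocks_def)
      with b_unique[OF B that] f(1) show ?thesis by simp
    qed
    ultimately show ?thesis using b(2) unfolding subblocks_def by blast
  qed
  have "star_block x f (R B) = B" if B: "B \<in> y" for B
  proof (rule prod_eqI)
    show "fst (star_block x f (R B)) = fst B"
      using subblocks_Union[OF x y r B] by (simp add: star_block_def Let_def fib[OF B])
    show "snd (star_block x f (R B)) = snd B"
      using R(2)[OF B] by (simp add: star_block_def Let_def fib[OF B] subweight_def)
  qed
  moreover have "f ` x = R ` y"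
  proof
    show "f ` x \<subseteq> R ` y" using f(1) b(1) by auto
    show "R ` y \<subseteq> f ` x" using fR Rx by force
  qed
  ultimately have y_eq: "star_block x f ` f ` x = y" by (simp add: image_image)
  have "inj_on R y" by (rule inj_onI) (metis R(1) b_unique)
  then have "card (f ` x) + j = card x" using j \<open>f ` x = R ` y\<close> by (simp add: card_image)
  moreover have "f (f v) = f v" if "v \<in> x" for v using f[OF that] fR b(1)[OF that] by simp
  moreover have "f \<in> x \<rightarrow>\<^sub>E x" using f(2) by (auto simp: f_def)
  ultimately have "f \<in> idempotents x j" by (simp add: idempotents_def)
  then show ?thesis using y_eq by (rule that)
qed

text \<open>The right side sees \<open>x\<close> only through \<open>card x\<close>. At the minimum
  this gives the Whitney numbers of the second kind, and at general \<open>x\<close> the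
  coefficients of the system for those of the first kind.\<close>

lemma card_refined_by:
  "card {y \<in> weighted_partitions n. finer x y \<and> card y + j = card x} = card (stars {1..card x} j)"
proof -
  have "bij_betw (\<lambda>f. star_block x f ` f ` x) (idempotents x j)
      {y \<in> weighted_partitions n. finer x y \<and> card y + j = card x}"
    unfolding bij_betw_def
  proof (intro conjI star_blocks_inj subset_antisym subsetI)
    fix y assume "y \<in> (\<lambda>f. star_block x f ` f ` x) ` idempotents x j"
    then show "y \<in> {y \<in> weighted_partitions n. finer x y \<and> card y + j = card x}"
      using star_blocks_weighted_partition by blast
  next
    fix y assume "y \<in> {y \<in> weighted_partitions n. finer x y \<and> card y + j = card x}"
    then have "y \<in> weighted_partitions n" "finer x y" "card y + j = card x" by auto
    then obtain f where "f \<in> idempotents x j" "star_block x f ` f ` x = y" by (rule star_blocks_surj)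
    then show "y \<in> (\<lambda>f. star_block x f ` f ` x) ` idempotents x j" by blast
  qed
  then have "card {y \<in> weighted_partitions n. finer x y \<and> card y + j = card x} = card (idempotents x j)"
    by (simp add: bij_betw_same_card)
  also have "\<dots> = card (stars x j)" by (rule card_idempotents[OF weighted_partitions_finite[OF x]])
  also have "\<dots> = card (stars {1..card x} j)"
    by (rule card_stars_cong) (simp_all add: weighted_partitions_finite[OF x])
  finally show ?thesis .
qed

end

section \<open>Rooted forests\<close>

text \<open>A rooted forest is the set of its edges \<open>(parent, child)\<close>.\<close>

definition forests :: "'a set \<Rightarrow> 'a rel set" where
  "forests V = {F. F \<subseteq> V \<times> V \<and> inj_on snd F \<and> acyclic F}"

lemma finite_forests: "finite V \<Longrightarrow> finite (forests V)"
  by (rule finite_subset[of _ "Pow (V \<times> V)"]) (auto simp: forests_def)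

lemma forests_finite: "finite V \<Longrightarrow> F \<in> forests V \<Longrightarrow> finite F"
  using finite_subset[OF _ finite_cartesian_product] by (auto simp: forests_def)

lemma forests_subset: "F \<in> forests V \<Longrightarrow> G \<subseteq> F \<Longrightarrow> G \<in> forests V"
  by (auto simp: forests_def intro: inj_on_subset acyclic_subset)

text \<open>An edge of \<open>S\<close> can only be the first edge of a path, because nothing enters
  its source. On a cycle every vertex is entered, so a cycle would lie inside
  \<open>F\<close>.\<close>

lemma acyclic_Un_roots:
  assumes F: "acyclic F" and S: "fst ` S \<inter> snd ` (F \<union> S) = {}"
  shows "acyclic (F \<union> S)"
proof (rule acyclicI, intro allI notI)
  have *: "(x, y) \<in> F\<^sup>+ \<or> x \<notin> snd ` (F \<union> S)" if "(x, y) \<in> (F \<union> S)\<^sup>+" for x y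
    using that
  proof (induction rule: trancl_induct)
    case (base y)
    then show ?case using S by (force intro: r_into_trancl)
  next
    case (step y z)
    have "y \<in> snd ` (F \<union> S)" using step.hyps(1) by (metis image_eqI snd_conv tranclE)
    then have "(y, z) \<in> F" using step.hyps(2) S by force
    with step.IH show ?case by (auto intro: trancl_into_trancl)
  qed
  fix x assume x: "(x, x) \<in> (F \<union> S)\<^sup>+"
  then have "x \<in> snd ` (F \<union> S)" by (metis image_eqI snd_conv tranclE)
  with *[OF x] F show False by (auto simp: acyclic_def)
qed

lemma forests_Un_roots:
  assumes F: "F \<in> forests V" and S: "S \<subseteq> V \<times> V" "inj_on snd S" "snd ` F \<inter> snd ` S = {}"
    "fst ` S \<inter> snd ` (F \<union> S) = {}"
  shows "F \<union> S \<in> forests V"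
proof -
  have "inj_on snd (F \<union> S)"
    using F S(2,3) by (auto simp: forests_def inj_on_Un)
  then show ?thesis using F S acyclic_Un_roots by (auto simp: forests_def)
qed

definition root_edges :: "'a rel \<Rightarrow> 'a rel" where
  "root_edges G = {e \<in> G. fst e \<notin> snd ` G}"

definition leaf_edges :: "'a rel \<Rightarrow> 'a rel" where
  "leaf_edges G = {e \<in> G. snd e \<notin> fst ` G}"

lemma root_edges_nonempty:
  assumes "finite G" "acyclic G" "G \<noteq> {}"
  shows "root_edges G \<noteq> {}"
proof -
  have "wf G" using assms finite_acyclic_wf by blast
  moreover obtain p where "p \<in> fst ` G" using assms(3) by auto
  ultimately obtain r where r: "r \<in> fst ` G" "\<And>y. (y, r) \<in> G \<Longrightarrow> y \<notin> fst ` G"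
    unfolding wf_eq_minimal by metis
  then have "r \<notin> snd ` G" by force
  moreover obtain c where "(r, c) \<in> G" using r(1) by auto
  ultimately have "(r, c) \<in> root_edges G" by (simp add: root_edges_def)
  then show ?thesis by blast
qed

lemma leaf_edges_nonempty:
  assumes "finite G" "acyclic G" "G \<noteq> {}"
  shows "leaf_edges G \<noteq> {}"
proof -
  have "root_edges (G\<inverse>) \<noteq> {}" using assms by (intro root_edges_nonempty) auto
  then obtain c p where "(p, c) \<in> G" "c \<notin> snd ` (G\<inverse>)" unfolding root_edges_def by fastforce
  moreover have "snd ` (G\<inverse>) = fst ` G" by force
  ultimately have "(p, c) \<in> leaf_edges G" by (simp add: leaf_edges_def)
  then show ?thesis by blast
qed

text \<open>Pairs of a forest \<open>F\<close> and a star forest \<open>S\<close> on its roots correspond to a forest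
  \<open>G = F \<union> S\<close> with a set \<open>S\<close> of edges at the roots of \<open>G\<close>.\<close>

lemma forest_star_reciprocity:
  fixes V :: "'a set"
  assumes V: "finite V"
  shows "(\<Sum>F\<in>{F \<in> forests V. card F \<le> k}.
      (- 1) ^ card F * int (card (stars (V - snd ` F) (k - card F)))) = of_bool (k = 0)"
proof -
  let ?P = "SIGMA F:{F \<in> forests V. card F \<le> k}. stars (V - snd ` F) (k - card F)"
  let ?Q = "SIGMA G:{G \<in> forests V. card G = k}. Pow (root_edges G)"
  have fin: "finite F" if "F \<in> forests V" for F using forests_finite[OF V that] .
  have fin_root: "finite (root_edges G)" if "G \<in> forests V" for G
    using fin[OF that] by (simp add: root_edges_def)
  have "(\<Sum>F\<in>{F \<in> forests V. card F \<le> k}.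
      (- 1) ^ card F * int (card (stars (V - snd ` F) (k - card F)))) =
      (\<Sum>F\<in>{F \<in> forests V. card F \<le> k}. \<Sum>S\<in>stars (V - snd ` F) (k - card F). (- 1) ^ card F)"
    by (simp add: mult.commute)
  also have "\<dots> = (\<Sum>(F, S)\<in>?P. (- 1) ^ card F)"
    using finite_forests[OF V] finite_stars V by (subst sum.Sigma) auto
  also have "\<dots> = (\<Sum>(G, S)\<in>?Q. (- 1) ^ (k + card S))"
  proof (rule sum.reindex_bij_witness[where i = "\<lambda>(G, S). (G - S, S)" and j = "\<lambda>(F, S). (F \<union> S, S)"])
    fix a assume "a \<in> ?P"
    then obtain F S where a: "a = (F, S)" and F: "F \<in> forests V" "card F \<le> k"
      and S: "S \<subseteq> (V - snd ` F) \<times> (V - snd ` F)" "inj_on snd S" "fst ` S \<inter> snd ` S = {}" "card S = k - card F"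
      by (auto simp: stars_def)
    have disj: "F \<inter> S = {}" using S(1) by force
    have ends: "fst ` S \<subseteq> V - snd ` F" "snd ` S \<subseteq> V - snd ` F"
      using subsetD[OF S(1)] unfolding mem_Times_iff by (intro image_subsetI, blast)+
    then have snd_disj: "snd ` F \<inter> snd ` S = {}" by blast
    have roots: "fst ` S \<inter> snd ` (F \<union> S) = {}" using ends S(3) unfolding image_Un by blast
    have "F \<union> S \<in> forests V"
      by (rule forests_Un_roots[OF F(1) _ S(2) snd_disj roots]) (use S(1) in auto)
    moreover have finS: "finite S" using V finite_subset[OF S(1)] by simp
    then have card: "card (F \<union> S) = k"
      using card_Un_disjoint[OF fin[OF F(1)] _ disj] S(4) F(2) by simp
    moreover have "S \<subseteq> root_edges (F \<union> S)" using roots by (auto simp: root_edges_def)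
    ultimately show "(case a of (F, S) \<Rightarrow> (F \<union> S, S)) \<in> ?Q" by (simp add: a)
    show "(case case a of (F, S) \<Rightarrow> (F \<union> S, S) of (G, S) \<Rightarrow> (G - S, S)) = a"
      using disj by (auto simp: a)
    \<comment> \<open>The two exponents have the same parity, so the signs agree.\<close>
    have "k + card S = card F + 2 * card S" using S(4) F(2) by simp
    then show "(case case a of (F, S) \<Rightarrow> (F \<union> S, S) of (G, S) \<Rightarrow> (- 1) ^ (k + card S)) =
        (case a of (F, S) \<Rightarrow> (- 1 :: int) ^ card F)"
      by (simp add: a power_add power_mult)
  next
    fix a assume "a \<in> ?Q"
    then obtain G S where a: "a = (G, S)" and G: "G \<in> forests V" "card G = k" and S: "S \<subseteq> root_edges G"
      by auto
    have SG: "S \<subseteq> G" and S_root: "fst ` S \<inter> snd ` G = {}" using S by (auto simp: root_edges_def)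
    have inj: "inj_on snd G" "G \<subseteq> V \<times> V" using G by (auto simp: forests_def)
    have finS: "finite S" using SG fin[OF G(1)] finite_subset by blast
    \<comment> \<open>A vertex has at most one parent, so removing \<open>S\<close> turns its
      children into roots, while its parents were roots already. Hence \<open>S\<close> lives on the
      roots of \<open>G - S\<close>.\<close>
    have disj: "snd ` (G - S) \<inter> snd ` S = {}"
      using inj_on_image_set_diff[OF inj(1), of G S] SG by auto
    have "S \<subseteq> (V - snd ` (G - S)) \<times> (V - snd ` (G - S))"
    proof
      fix e assume e: "e \<in> S"
      then have "fst e \<in> V" "snd e \<in> V" using SG inj(2) mem_Times_iff by blast+
      moreover have "fst e \<notin> snd ` (G - S)" using e S_root by blast
      moreover have "snd e \<notin> snd ` (G - S)" using e disj by blast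
      ultimately show "e \<in> (V - snd ` (G - S)) \<times> (V - snd ` (G - S))" by (simp add: mem_Times_iff)
    qed
    moreover have "fst ` S \<inter> snd ` S = {}" using S_root SG by blast
    moreover have card: "card S = k - card (G - S)" "card (G - S) \<le> k"
      using card_Diff_subset[OF finS SG] card_mono[OF fin[OF G(1)] SG] G(2) by auto
    ultimately have "S \<in> stars (V - snd ` (G - S)) (k - card (G - S))"
      using inj_on_subset[OF inj(1) SG] by (simp add: stars_def)
    with card show "(case a of (G, S) \<Rightarrow> (G - S, S)) \<in> ?P"
      using forests_subset[OF G(1), of "G - S"] by (auto simp: a)
    show "(case case a of (G, S) \<Rightarrow> (G - S, S) of (F, S) \<Rightarrow> (F \<union> S, S)) = a"
      using SG by (auto simp: a)
  qed
  also have "\<dots> = (\<Sum>G\<in>{G \<in> forests V. card G = k}. \<Sum>S\<in>Pow (root_edges G). (- 1) ^ (k + card S))"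
    using finite_forests[OF V] fin_root by (subst sum.Sigma) auto
  also have "\<dots> = (\<Sum>G\<in>{G \<in> forests V. card G = k}. of_bool (k = 0))"
  proof (rule sum.cong[OF refl])
    fix G assume "G \<in> {G \<in> forests V. card G = k}"
    then have G: "G \<in> forests V" "card G = k" by auto
    show "(\<Sum>S\<in>Pow (root_edges G). (- 1) ^ (k + card S)) = (of_bool (k = 0) :: int)"
    proof (cases "k = 0")
      case True
      then have "G = {}" using G fin by simp
      then show ?thesis using True by (simp add: root_edges_def)
    next
      case False
      then have "G \<noteq> {}" using G(2) by auto
      then have "root_edges G \<noteq> {}"
        using root_edges_nonempty[OF fin[OF G(1)]] G(1) by (simp add: forests_def)
      then have "(\<Sum>S\<in>Pow (root_edges G). (- 1) ^ card S) = (0 :: int)"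
        using fin_root[OF G(1)] sum_minus_one_power_Pow by blast
      then show ?thesis using False by (simp add: power_add flip: sum_distrib_left)
    qed
  qed
  also have "\<dots> = of_bool (k = 0)"
  proof (cases "k = 0")
    case True
    have "{G \<in> forests V. card G = 0} = {{}}"
      using fin by (auto simp: forests_def acyclic_def)
    then show ?thesis using True by simp
  qed simp
  finally show ?thesis .
qed

section \<open>The poset of rooted forests\<close>

text \<open>\<open>F \<le> G\<close> holds if \<open>G\<close> arises from \<open>F\<close> by repeatedly joining two trees by an edge between
  their roots; equivalently, \<open>F\<close> contains with an edge all edges of \<open>G\<close> below it.\<close>

definition forest_le :: "'a rel \<Rightarrow> 'a rel \<Rightarrow> bool" where
  "forest_le F G \<longleftrightarrow> F \<subseteq> G \<and> (\<forall>g p c. (g, p) \<in> F \<longrightarrow> (p, c) \<in> G \<longrightarrow> (p, c) \<in> F)"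

text \<open>A leaf edge \<open>(p, c)\<close> of \<open>G - F\<close> can be added: all edges of
  \<open>G\<close> that start at \<open>c\<close> are in \<open>F\<close>, and no edge of
  \<open>F\<close> ends at \<open>p\<close>, since otherwise \<open>(p, c)\<close> would be in
  \<open>F\<close> already.\<close>

lemma forest_le_step:
  assumes G: "finite G" "acyclic G" and le: "forest_le F G" and "F \<noteq> G"
  obtains e where "e \<in> G - F" "forest_le F (insert e F)" "forest_le (insert e F) G"
proof -
  have FG: "F \<subseteq> G" using le by (simp add: forest_le_def)
  have "leaf_edges (G - F) \<noteq> {}"
    using G FG \<open>F \<noteq> G\<close> by (intro leaf_edges_nonempty acyclic_subset[OF G(2)]) auto
  then obtain p c where e: "(p, c) \<in> G - F" "c \<notin> fst ` (G - F)" by (auto simp: leaf_edges_def)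
  have "forest_le F (insert (p, c) F)"
    using le e by (auto simp: forest_le_def)
  moreover have "forest_le (insert (p, c) F) G"
    using le e by (force simp: forest_le_def)
  ultimately show ?thesis using that e by blast
qed

definition star_sign :: "'a rel \<Rightarrow> int" where
  "star_sign F = (if fst ` F \<inter> snd ` F = {} then (- 1) ^ card F else 0)"

text \<open>The star forests below \<open>G\<close> are the sets of leaf edges of \<open>G\<close>:
  an edge of \<open>F\<close> with an edge of \<open>G\<close> below it would bring that edge into
  \<open>F\<close> and so create a path of length two. What remains is an alternating sum over a
  power set.\<close>

lemma sum_star_sign:
  assumes V: "finite V" and G: "G \<in> forests V"
  shows "(\<Sum>F\<in>{F \<in> forests V. forest_le F G}. star_sign F) = of_bool (G = {})"
proof -
  have stars_eq: "{F \<in> forests V. forest_le F G} \<inter> {F. fst ` F \<inter> snd ` F = {}} = Pow (leaf_edges G)"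
  proof (intro subset_antisym subsetI)
    fix F assume "F \<in> {F \<in> forests V. forest_le F G} \<inter> {F. fst ` F \<inter> snd ` F = {}}"
    then have F: "forest_le F G" "fst ` F \<inter> snd ` F = {}" by auto
    have "e \<in> leaf_edges G" if e: "e \<in> F" for e
    proof (rule ccontr)
      obtain p c where pc: "e = (p, c)" by (cases e)
      assume "e \<notin> leaf_edges G"
      then have "c \<in> fst ` G" using e pc F(1) by (auto simp: forest_le_def leaf_edges_def)
      then obtain d where "(c, d) \<in> G" by auto
      then have "(c, d) \<in> F" using F(1) e pc by (auto simp: forest_le_def)
      then have "c \<in> fst ` F" "c \<in> snd ` F" using e pc by force+
      with F(2) show False by blast
    qed
    then show "F \<in> Pow (leaf_edges G)" by blast
  next
    fix F assume "F \<in> Pow (leaf_edges G)"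
    then have F: "F \<subseteq> G" "snd ` F \<inter> fst ` G = {}" by (auto simp: leaf_edges_def)
    have "(p, c) \<notin> G" if "(g, p) \<in> F" for g p c using that F(2) by force
    then have "forest_le F G" using F(1) by (auto simp: forest_le_def)
    then show "F \<in> {F \<in> forests V. forest_le F G} \<inter> {F. fst ` F \<inter> snd ` F = {}}"
      using F forests_subset[OF G F(1)] by auto
  qed
  have "(\<Sum>F\<in>{F \<in> forests V. forest_le F G}. star_sign F) =
      (\<Sum>F\<in>Pow (leaf_edges G). (- 1) ^ card F)"
    unfolding stars_eq[symmetric]
    by (rule sum.mono_neutral_cong_right) (auto simp: star_sign_def finite_forests[OF V])
  also have "\<dots> = of_bool (G = {})"
  proof (cases "G = {}")
    case False
    then have "leaf_edges G \<noteq> {}" using leaf_edges_nonempty[OF forests_finite[OF V G]] G by (simp add: forests_def)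
    moreover have "finite (leaf_edges G)" using forests_finite[OF V G] by (simp add: leaf_edges_def)
    ultimately show ?thesis using sum_minus_one_power_Pow False by simp
  qed (simp add: leaf_edges_def)
  finally show ?thesis .
qed

section \<open>The graded poset of coded forests and its Whitney numbers\<close>

text \<open>\<open>has_whitney_dual\<close> asks for a carrier of natural numbers. The forest order
  is transported along an arbitrary bijection \<open>dec\<close>, so the concrete code enters only
  in the final step.\<close>

locale coded_forests =
  fixes V :: "'v set" and B :: "'b set" and dec :: "'b \<Rightarrow> 'v rel"
  assumes finite_V: "finite V" and V_nonempty: "V \<noteq> {}" and dec: "bij_betw dec B (forests V)"
begin

definition forest_rel :: "'b rel" where
  "forest_rel = {(a, b) \<in> B \<times> B. forest_le (dec a) (dec b)}"

lemma dec_forest: "a \<in> B \<Longrightarrow> dec a \<in> forests V"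
  using dec bij_betwE by blast

lemma dec_inject: "a \<in> B \<Longrightarrow> b \<in> B \<Longrightarrow> dec a = dec b \<Longrightarrow> a = b"
  using dec by (auto simp: bij_betw_def dest: inj_onD)

lemma dec_surj: assumes "F \<in> forests V" obtains a where "a \<in> B" "dec a = F"
proof -
  have "F \<in> dec ` B" using assms bij_betw_imp_surj_on[OF dec] by simp
  then show ?thesis using that by (elim imageE) simp
qed

definition code_empty :: 'b where
  "code_empty = (THE a. a \<in> B \<and> dec a = {})"

lemma code_empty: "code_empty \<in> B" "dec code_empty = {}"
proof -
  have "{} \<in> forests V" by (simp add: forests_def acyclic_def)
  then obtain a where "a \<in> B \<and> dec a = {}" using dec_surj by metis
  then have "code_empty \<in> B \<and> dec code_empty = {}"
    unfolding code_empty_def by (rule theI) (use dec_inject \<open>a \<in> B \<and> dec a = {}\<close> in auto)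
  then show "code_empty \<in> B" "dec code_empty = {}" by auto
qed

lemma card_forest_less: assumes F: "F \<in> forests V" shows "card F < card V"
proof (cases "F = {}")
  case True
  then show ?thesis using finite_V V_nonempty by (simp add: card_gt_0_iff)
next
  case False
  then obtain e where e: "e \<in> F" "fst e \<notin> snd ` F"
    using root_edges_nonempty[OF forests_finite[OF finite_V F]] F
    by (auto simp: forests_def root_edges_def)
  have "card F = card (snd ` F)" using F by (simp add: forests_def card_image)
  also have "\<dots> < card V"
    by (rule psubset_card_mono[OF finite_V]) (use F e in \<open>force simp: forests_def\<close>)
  finally show ?thesis .
qed

text \<open>Each edge has its own child, so \<open>card V - card F\<close> roots are left. While
  there are two of them, they can be joined.\<close>

lemma forest_extend:
  assumes F: "F \<in> forests V" and card: "card F < card V - 1"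
  obtains H where "H \<in> forests V" "forest_le F H" "F \<noteq> H"
proof -
  have sub: "snd ` F \<subseteq> V" and inj: "inj_on snd F" using F by (auto simp: forests_def)
  then have "card (V - snd ` F) = card V - card F"
    using finite_V by (simp add: card_Diff_subset finite_subset card_image)
  then have "2 \<le> card (V - snd ` F)" using card by linarith
  then obtain r s where rs: "r \<in> V - snd ` F" "s \<in> V - snd ` F" "r \<noteq> s"
    using card_ge_2_other by metis
  have "F \<union> {(s, r)} \<in> forests V"
    by (rule forests_Un_roots[OF F]) (use rs in auto)
  moreover have "forest_le F (F \<union> {(s, r)})" using rs by (force simp: forest_le_def)
  moreover have "F \<noteq> F \<union> {(s, r)}" using rs by force
  ultimately show ?thesis by (rule that)
qed

sublocale ranked_poset B forest_rel code_empty "\<lambda>a. card (dec a)" "card V - 1"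
proof
  have finite_dec: "finite (dec a)" if "a \<in> B" for a using forests_finite[OF finite_V dec_forest[OF that]] .
  show "finite B" using bij_betw_finite[OF dec] finite_forests[OF finite_V] by simp
  have "refl_on B forest_rel" by (auto simp: refl_on_def forest_rel_def forest_le_def)
  moreover have "trans forest_rel"
    unfolding trans_def forest_rel_def forest_le_def by blast
  moreover have "antisym forest_rel"
    using dec_inject unfolding antisym_def forest_rel_def forest_le_def by blast
  moreover have "forest_rel \<subseteq> B \<times> B" by (auto simp: forest_rel_def)
  ultimately show "partial_order_on B forest_rel"
    by (simp add: partial_order_on_def preorder_on_def)
  show "is_minimum B forest_rel code_empty"
    by (simp add: is_minimum_def forest_rel_def forest_le_def code_empty)
  show "card (dec code_empty) = 0" by (simp add: code_empty)
  have strict: "strictly_below forest_rel a b \<longleftrightarrow>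
      a \<in> B \<and> b \<in> B \<and> forest_le (dec a) (dec b) \<and> dec a \<noteq> dec b" for a b
    using dec_inject by (auto simp: strictly_below_def forest_rel_def)
  show "card (dec a) < card (dec b)" if "strictly_below forest_rel a b" for a b
    using that by (intro psubset_card_mono finite_dec) (auto simp: strict forest_le_def)
  show "\<exists>z. strictly_below forest_rel a z \<and> (z, b) \<in> forest_rel \<and> card (dec z) = Suc (card (dec a))"
    if ab: "strictly_below forest_rel a b" for a b
  proof -
    have ab: "a \<in> B" "b \<in> B" "forest_le (dec a) (dec b)" "dec a \<noteq> dec b" using ab by (auto simp: strict)
    have b: "dec b \<in> forests V" "acyclic (dec b)" using dec_forest[OF ab(2)] by (auto simp: forests_def)
    obtain e where e: "e \<in> dec b - dec a" "forest_le (dec a) (insert e (dec a))"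
      "forest_le (insert e (dec a)) (dec b)"
      using forest_le_step[OF finite_dec[OF ab(2)] b(2) ab(3,4)] by metis
    have "insert e (dec a) \<in> forests V"
      using forests_subset[OF b(1)] e(3) by (simp add: forest_le_def)
    then obtain z where z: "z \<in> B" "dec z = insert e (dec a)" by (rule dec_surj)
    have "strictly_below forest_rel a z" using ab z e by (auto simp: strict)
    moreover have "(z, b) \<in> forest_rel" using ab z e by (simp add: forest_rel_def)
    moreover have "card (dec z) = Suc (card (dec a))" using z e finite_dec[OF ab(1)] by simp
    ultimately show ?thesis by blast
  qed
  show "card (dec a) \<le> card V - 1" if "a \<in> B" for a
    using card_forest_less[OF dec_forest[OF that]] by linarith
  show "\<exists>b. strictly_below forest_rel a b" if a: "a \<in> B" and less: "card (dec a) < card V - 1" for a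
  proof -
    obtain H where H: "H \<in> forests V" "forest_le (dec a) H" "dec a \<noteq> H"
      using forest_extend[OF dec_forest[OF a] less] .
    obtain b where "b \<in> B" "dec b = H" using dec_surj[OF H(1)] .
    with H a have "strictly_below forest_rel a b" by (simp add: strict)
    then show ?thesis by blast
  qed
qed

lemma sum_dec: "(\<Sum>a\<in>{a \<in> B. P (dec a)}. g (dec a)) = (\<Sum>F\<in>{F \<in> forests V. P F}. g F)"
proof -
  have image: "dec ` {a \<in> B. P (dec a)} = {F \<in> forests V. P F}"
    unfolding bij_betw_imp_surj_on[OF dec, symmetric] by blast
  have "inj_on dec {a \<in> B. P (dec a)}"
    by (rule inj_on_subset[OF bij_betw_imp_inj_on[OF dec]]) blast
  then show ?thesis unfolding image[symmetric] by (simp add: sum.reindex)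
qed

lemma moebius_forest: assumes "a \<in> B" shows "moebius forest_rel code_empty a = star_sign (dec a)"
proof (rule moebius_unique[OF _ assms])
  fix b assume b: "b \<in> B"
  have "{a. (a, b) \<in> forest_rel} = {a \<in> B. forest_le (dec a) (dec b)}"
    using b by (auto simp: forest_rel_def)
  then have "(\<Sum>a\<in>{a. (a, b) \<in> forest_rel}. star_sign (dec a)) = of_bool (dec b = {})"
    using sum_dec[of star_sign "\<lambda>F. forest_le F (dec b)"] sum_star_sign[OF finite_V dec_forest[OF b]]
    by simp
  moreover have "dec b = {} \<longleftrightarrow> b = code_empty"
    using code_empty(2) dec_inject[OF b code_empty(1)] by metis
  ultimately show "(\<Sum>a\<in>{a. (a, b) \<in> forest_rel}. star_sign (dec a)) = (if b = code_empty then 1 else 0)"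
    by simp
qed

lemma whitney_second_forest: "whitney_second B forest_rel k = card {F \<in> forests V. card F = k}"
  using sum_dec[of "\<lambda>_. 1 :: nat" "\<lambda>F. card F = k"] by (simp add: whitney_second_rank)

lemma whitney_first_forest: "whitney_first B forest_rel k = (- 1) ^ k * int (card (stars V k))"
proof -
  have "whitney_first B forest_rel k = (\<Sum>a\<in>{a \<in> B. card (dec a) = k}. star_sign (dec a))"
    unfolding whitney_first_rank by (rule sum.cong) (auto simp: moebius_forest)
  also have "\<dots> = (\<Sum>F\<in>{F \<in> forests V. card F = k}. star_sign F)" by (rule sum_dec)
  also have "\<dots> = (\<Sum>F\<in>stars V k. (- 1) ^ k)"
  proof (rule sum.mono_neutral_cong_right)
    show "stars V k \<subseteq> {F \<in> forests V. card F = k}"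
    proof
      fix S assume "S \<in> stars V k"
      then have S: "S \<subseteq> V \<times> V" "inj_on snd S" "fst ` S \<inter> snd ` S = {}" "card S = k"
        by (auto simp: stars_def)
      have "acyclic ({} \<union> S)" by (rule acyclic_Un_roots) (use S(3) in \<open>auto simp: acyclic_def\<close>)
      with S show "S \<in> {F \<in> forests V. card F = k}" by (simp add: forests_def)
    qed
    show "finite {F \<in> forests V. card F = k}" using finite_forests[OF finite_V] by simp
  qed (auto simp: star_sign_def stars_def forests_def)
  finally show ?thesis by simp
qed

end

section \<open>The Whitney dual\<close>

text \<open>The system is triangular with ones on the diagonal.\<close>

lemma convolution_unique:
  fixes w w' :: "nat \<Rightarrow> int"
  assumes "\<And>i. s i 0 = 1"
    and w: "\<And>k. (\<Sum>i\<le>k. w i * s i (k - i)) = d k" and w': "\<And>k. (\<Sum>i\<le>k. w' i * s i (k - i)) = d k"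
  shows "w k = w' k"
proof (induction k rule: less_induct)
  case (less k)
  have split: "(\<Sum>i\<le>k. v i * s i (k - i)) = v k + (\<Sum>i<k. v i * s i (k - i))" for v :: "nat \<Rightarrow> int"
    by (simp add: lessThan_Suc_atMost[symmetric] assms(1))
  have "(\<Sum>i<k. w i * s i (k - i)) = (\<Sum>i<k. w' i * s i (k - i))"
    using less by (intro sum.cong) auto
  then show ?case using w[of k] w'[of k] by (simp add: split)
qed

lemma whitney_second_wp:
  assumes n: "n \<ge> 1"
  shows "whitney_second (weighted_partitions n) (wp_le n) k = card (stars {1..n} k)"
proof -
  interpret ranked_poset "weighted_partitions n" "wp_le n" "singletons n" "\<lambda>x. n - card x" "n - 1"
    by (rule ranked_poset_weighted_partitions[OF n])
  have card: "card (singletons n) = n"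
    unfolding singletons_def by (subst card_image) (auto simp: inj_on_def)
  have "n - card y = k \<longleftrightarrow> card y + k = n" if "y \<in> weighted_partitions n" for y
    using weighted_partitions_card(1)[OF that] by linarith
  then have "{y \<in> weighted_partitions n. n - card y = k} =
      {y \<in> weighted_partitions n. finer (singletons n) y \<and> card y + k = card (singletons n)}"
    using singletons_finer card by auto
  then show ?thesis
    using card_refined_by[OF singletons_weighted_partitions, of n k] card by (simp add: whitney_second_rank)
qed

lemma whitney_first_wp:
  assumes n: "n \<ge> 1"
  shows "whitney_first (weighted_partitions n) (wp_le n) k = (- 1) ^ k * int (card {F \<in> forests {1..n}. card F = k})"
proof -
  interpret ranked_poset "weighted_partitions n" "wp_le n" "singletons n" "\<lambda>x. n - card x" "n - 1"
    by (rule ranked_poset_weighted_partitions[OF n])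
  let ?A = "weighted_partitions n"
  let ?\<mu> = "moebius (wp_le n) (singletons n)"
  define s :: "nat \<Rightarrow> nat \<Rightarrow> int" where "s i j = int (card (stars {1..n - i} j))" for i j
  have "(\<Sum>i\<le>k. whitney_first ?A (wp_le n) i * s i (k - i)) = of_bool (k = 0)" for k
  proof -
    \<comment> \<open>With \<open>i = n - card x\<close>, an element of rank \<open>k\<close> above
      \<open>x\<close> takes \<open>k - i\<close> merges among \<open>n - i\<close> blocks. The
      count depends on \<open>x\<close> through \<open>i\<close> alone.\<close>
    have above: "int (card {y \<in> ?A. n - card y = k \<and> (x, y) \<in> wp_le n}) =
        (if n - card x \<le> k then s (n - card x) (k - (n - card x)) else 0)" if x: "x \<in> ?A" for x
    proof (cases "n - card x \<le> k")
      case True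
      define j where "j = k - (n - card x)"
      have "n - card y = k \<longleftrightarrow> card y + j = card x" if "y \<in> ?A" "finer x y" for y
        using weighted_partitions_card(1)[OF x] weighted_partitions_card(1)[OF that(1)]
          weighted_partitions_card(2)[OF that(1) n] True
        using wp_cover_rtrancl_card[OF finer_rtrancl[OF x that]] by (auto simp: j_def)
      then have "{y \<in> ?A. n - card y = k \<and> (x, y) \<in> wp_le n} =
          {y \<in> ?A. finer x y \<and> card y + j = card x}"
        using x by (auto simp: wp_le_iff)
      moreover have "n - (n - card x) = card x" using weighted_partitions_card(1)[OF x] by simp
      ultimately show ?thesis
        using card_refined_by[OF x, of j] True unfolding s_def j_def[symmetric] by simp
    next
      case False
      have "n - card x \<le> n - card y" if "(x, y) \<in> wp_le n" for y
        using rank_mono[of x y] that by (cases "x = y") (auto simp: strictly_below_def)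
      then have "{y \<in> ?A. n - card y = k \<and> (x, y) \<in> wp_le n} = {}" using False by fastforce
      with False show ?thesis by (metis card.empty of_nat_0)
    qed
    have "(\<Sum>i\<le>k. whitney_first ?A (wp_le n) i * s i (k - i)) =
        (\<Sum>i\<le>k. \<Sum>x\<in>{x \<in> {x \<in> ?A. n - card x \<le> k}. n - card x = i}. ?\<mu> x * s (n - card x) (k - (n - card x)))"
    proof (rule sum.cong[OF refl])
      fix i assume "i \<in> {..k}"
      then have "{x \<in> {x \<in> ?A. n - card x \<le> k}. n - card x = i} = {x \<in> ?A. n - card x = i}" by auto
      then show "whitney_first ?A (wp_le n) i * s i (k - i) =
          (\<Sum>x\<in>{x \<in> {x \<in> ?A. n - card x \<le> k}. n - card x = i}. ?\<mu> x * s (n - card x) (k - (n - card x)))"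
        by (simp add: whitney_first_rank sum_distrib_right)
    qed
    also have "\<dots> = (\<Sum>x\<in>{x \<in> ?A. n - card x \<le> k}. ?\<mu> x * s (n - card x) (k - (n - card x)))"
      by (rule sum.group) (auto simp: finite_weighted_partitions)
    \<comment> \<open>Elements of rank above \<open>k\<close> may join the sum because nothing of
      rank \<open>k\<close> lies above them. The sum now counts pairs of \<open>x\<close> below
      \<open>y\<close>, and exchanging the order brings in the Moebius recursion at each
      \<open>y\<close>.\<close>
    also have "\<dots> = (\<Sum>x\<in>?A. ?\<mu> x * int (card {y \<in> ?A. n - card y = k \<and> (x, y) \<in> wp_le n}))"
      by (rule sum.mono_neutral_cong_left) (auto simp: finite_weighted_partitions above)
    also have "\<dots> = (\<Sum>x\<in>?A. \<Sum>y\<in>{y \<in> {y \<in> ?A. n - card y = k}. (x, y) \<in> wp_le n}. ?\<mu> x)"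
      by (simp add: mult.commute conj_assoc)
    also have "\<dots> = (\<Sum>y\<in>{y \<in> ?A. n - card y = k}. \<Sum>x\<in>{x \<in> ?A. (x, y) \<in> wp_le n}. ?\<mu> x)"
      by (rule sum.swap_restrict) (auto simp: finite_weighted_partitions)
    also have "\<dots> = (\<Sum>y\<in>{y \<in> ?A. n - card y = k}. if y = singletons n then 1 else 0)"
    proof (rule sum.cong[OF refl])
      fix y assume "y \<in> {y \<in> ?A. n - card y = k}"
      moreover have "{x \<in> ?A. (x, y) \<in> wp_le n} = {x. (x, y) \<in> wp_le n}" using below_carrier by blast
      ultimately show "(\<Sum>x\<in>{x \<in> ?A. (x, y) \<in> wp_le n}. ?\<mu> x) = (if y = singletons n then 1 else 0)"
        using sum_moebius[of y] by simp
    qed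
    also have "\<dots> = of_bool (k = 0)"
      using rank_minimum minimum_carrier finite_weighted_partitions by (simp add: sum.delta)
    finally show ?thesis .
  qed
  moreover have "(\<Sum>i\<le>k. ((- 1) ^ i * int (card {F \<in> forests {1..n}. card F = i})) * s i (k - i)) =
      of_bool (k = 0)" for k
  proof -
    let ?F = "forests {1..n}"
    \<comment> \<open>The number of roots of \<open>F\<close> is \<open>n - card F\<close>, so the
      star forests on them are counted by the same coefficients.\<close>
    have s: "s (card F) j = int (card (stars ({1..n} - snd ` F) j))" if "F \<in> ?F" for F j
    proof -
      have "snd ` F \<subseteq> {1..n}" "inj_on snd F" using that by (auto simp: forests_def)
      then have "card ({1..n} - snd ` F) = n - card F"
        by (simp add: card_Diff_subset finite_subset card_image)
      then show ?thesis unfolding s_def by (intro arg_cong[where f = int] card_stars_cong) auto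
    qed
    have "(\<Sum>i\<le>k. ((- 1) ^ i * int (card {F \<in> ?F. card F = i})) * s i (k - i)) =
        (\<Sum>i\<le>k. \<Sum>F\<in>{F \<in> {F \<in> ?F. card F \<le> k}. card F = i}. (- 1) ^ card F * s (card F) (k - card F))"
    proof (rule sum.cong[OF refl])
      fix i assume "i \<in> {..k}"
      then have "{F \<in> {F \<in> ?F. card F \<le> k}. card F = i} = {F \<in> ?F. card F = i}" by auto
      then show "((- 1) ^ i * int (card {F \<in> ?F. card F = i})) * s i (k - i) =
          (\<Sum>F\<in>{F \<in> {F \<in> ?F. card F \<le> k}. card F = i}. (- 1) ^ card F * s (card F) (k - card F))"
        by simp
    qed
    also have "\<dots> = (\<Sum>F\<in>{F \<in> ?F. card F \<le> k}. (- 1) ^ card F * s (card F) (k - card F))"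
      by (rule sum.group) (auto simp: finite_forests)
    also have "\<dots> = (\<Sum>F\<in>{F \<in> ?F. card F \<le> k}.
        (- 1) ^ card F * int (card (stars ({1..n} - snd ` F) (k - card F))))"
      by (rule sum.cong) (auto simp: s)
    also have "\<dots> = of_bool (k = 0)" by (rule forest_star_reciprocity) simp
    finally show ?thesis .
  qed
  moreover have "s i 0 = 1" for i by (simp add: s_def card_stars_0)
  ultimately show ?thesis by (rule convolution_unique[rotated])
qed

lemma has_whitney_dual_wp:
  assumes n: "n \<ge> 1"
  shows "has_whitney_dual (weighted_partitions n) (wp_le n)"
proof -
  \<comment> \<open>Every natural number is read as a finite set of coded pairs; the carrier keeps
    those numbers whose relation is a forest.\<close>
  define dec :: "nat \<Rightarrow> nat rel" where "dec a = prod_decode ` set_decode a" for a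
  have "\<exists>a. dec a = F" if "F \<in> forests {1..n}" for F
  proof -
    have "finite F" using forests_finite[OF _ that] by simp
    then have "dec (set_encode (prod_encode ` F)) = F"
      by (simp add: dec_def image_image)
    then show ?thesis by blast
  qed
  moreover have "inj dec"
    by (rule injI) (auto simp: dec_def inj_image_eq_iff[OF inj_prod_decode] dest: arg_cong[where f = set_encode])
  ultimately have "bij_betw dec {a. dec a \<in> forests {1..n}} (forests {1..n})"
    by (auto simp: bij_betw_def inj_on_def inj_def image_iff)
  then interpret F: coded_forests "{1..n}" "{a. dec a \<in> forests {1..n}}" dec
    by unfold_locales (use n in auto)
  interpret ranked_poset "weighted_partitions n" "wp_le n" "singletons n" "\<lambda>x. n - card x" "n - 1"
    by (rule ranked_poset_weighted_partitions[OF n])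
  have "whitney_duals (weighted_partitions n) (wp_le n) {a. dec a \<in> forests {1..n}} F.forest_rel"
    unfolding whitney_duals_def whitney_first_wp[OF n] whitney_second_wp[OF n]
      F.whitney_first_forest F.whitney_second_forest
    using graded_poset F.graded_poset by (simp add: abs_mult power_abs del: One_nat_def)
  then show ?thesis unfolding has_whitney_dual_def by blast
qed

theorem theorem2p8:
  fixes n :: nat
  assumes "n \<ge> 1"
  shows "EW_labeling (weighted_partitions n) (wp_le n) (wp_Lambda n) (wp_Lambda_le n) wp_labeling
       \<and> has_whitney_dual (weighted_partitions n) (wp_le n)"
  using EW_labeling_wp[OF assms] has_whitney_dual_wp[OF assms] by blast

end
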